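(* Let $D=(V,E)$ be a digraph and $e\in E$. Then \[ \widehat{\sigma}(D)= \begin{cases} \widehat{\sigma}(D_{-e})+xy\,\widehat{\sigma}(D_{/e}) & \text{if } e \text{ is a loop},\\ \widehat{\sigma}(D_{-e})+x\,\widehat{\sigma}(D_{/e})-x\,\widehat{\sigma}(D_{\dagger e}) & \text{otherwise}, \end{cases} \] and \[ \widehat{\pi}(D)= \begin{cases} \widehat{\pi}(D_{-e}) & \text{if } e \text{ is a loop},\\ \widehat{\pi}(D_{-e})+x\,\widehat{\pi}(D_{/e})+x(y-1)\,\widehat{\pi}(D_{\dagger e}) & \text{otherwise}. \end{cases} \]
   Context: Digraphs are finite directed multigraphs; loops and multiple arcs are allowed. For $F\subseteq E$, $D\langle F\rangle$ denotes the spanning subgraph $(V,F)$. $kc(H)$ is the number of components of $H$ that are directed cycles (including loops). $kp(H)$ is the number of components of $H$ that are directed paths with at least one arc. The bivariate cycle polynomial is $\widehat{\sigma}(D;x,y)=\sum_F x^{|F|}y^{kc(D\langle F\rangle)}$, summed over all $F\subseteq E$ such that every component of $D\langle F\rangle$ is a directed cycle or an isolated vertex. The bivariate path polynomial is $\widehat{\pi}(D;x,y)=\sum_F x^{|F|}y^{kp(D\langle F\rangle)}$, summed over all $F\subseteq E$ such that every component of $D\langle F\rangle$ is a directed path or an isolated vertex. The arc operations are as follows. $D_{-e}$ deletes $e$. If $e=(u,v)$ with $u\ne v$, then $D_{/e}$ is obtained by removing all arcs with tail $u$ and all arcs with head $v$ (including $e$), and then identifying $u$ and $v$ into one new vertex.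 If $e=(u,u)$ is a loop, then $D_{/e}$ deletes $u$ and its incident arcs. For $e=(u,v)$, $D_{\dagger e}$ deletes $u$, $v$ and all arcs incident to them. *)

theory Defs
  imports
    "HOL-Computational_Algebra.Polynomial"
    "Graph_Theory.Digraph_Component"
begin

text \<open>
  Finite directed multigraphs, with loops and parallel arcs allowed, are those of the locale
  \<^locale>\<open>fin_digraph\<close>.
\<close>

definition spanning_sub :: "('a, 'b) pre_digraph \<Rightarrow> 'b set \<Rightarrow> ('a, 'b) pre_digraph" where
  "spanning_sub D F = \<lparr>verts = verts D, arcs = F, tail = tail D, head = head D\<rparr>"

text \<open>
  Components are taken in the weak sense: \<^const>\<open>Digraph_Component.connected\<close> is connectedness
  of the underlying undirected graph.
\<close>

definition components :: "('a, 'b) pre_digraph \<Rightarrow> ('a, 'b) pre_digraph set" where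
  "components D = {H. pre_digraph.max_subgraph D Digraph_Component.connected H}"

text \<open>A single loop is a directed cycle: \<^const>\<open>pre_digraph.cycle\<close> admits length one.\<close>

definition is_directed_cycle :: "('a, 'b) pre_digraph \<Rightarrow> bool" where
  "is_directed_cycle H \<longleftrightarrow>
     (\<exists>p. pre_digraph.cycle H p \<and> arcs H = set p \<and> verts H = tail H ` set p)"

text \<open>Only paths with at least one arc; the one-vertex path is an isolated vertex.\<close>

definition is_directed_path :: "('a, 'b) pre_digraph \<Rightarrow> bool" where
  "is_directed_path H \<longleftrightarrow>
     (\<exists>u p v. pre_digraph.apath H u p v \<and> p \<noteq> [] \<and>
        arcs H = set p \<and> verts H = set (pre_digraph.awalk_verts H u p))"

definition is_isolated_vertex :: "('a, 'b) pre_digraph \<Rightarrow> bool" where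
  "is_isolated_vertex H \<longleftrightarrow> (\<exists>v. verts H = {v}) \<and> arcs H = {}"

definition kc :: "('a, 'b) pre_digraph \<Rightarrow> nat" where
  "kc D = card {H \<in> components D. is_directed_cycle H}"

definition kp :: "('a, 'b) pre_digraph \<Rightarrow> nat" where
  "kp D = card {H \<in> components D. is_directed_path H}"

text \<open>
  Bivariate polynomials are polynomials in $x$ whose coefficients are polynomials in $y$.
\<close>

definition X :: "int poly poly" where
  "X = [:0, 1:]"

definition Y :: "int poly poly" where
  "Y = [:[:0, 1:]:]"

definition cycle_poly :: "('a, 'b) pre_digraph \<Rightarrow> int poly poly" where
  "cycle_poly D =
     (\<Sum>F | F \<subseteq> arcs D \<and>
            (\<forall>H \<in> components (spanning_sub D F). is_directed_cycle H \<or> is_isolated_vertex H).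
        X ^ card F * Y ^ kc (spanning_sub D F))"

definition path_poly :: "('a, 'b) pre_digraph \<Rightarrow> int poly poly" where
  "path_poly D =
     (\<Sum>F | F \<subseteq> arcs D \<and>
            (\<forall>H \<in> components (spanning_sub D F). is_directed_path H \<or> is_isolated_vertex H).
        X ^ card F * Y ^ kp (spanning_sub D F))"

definition arc_delete :: "('a, 'b) pre_digraph \<Rightarrow> 'b \<Rightarrow> ('a, 'b) pre_digraph" where
  "arc_delete D e = pre_digraph.del_arc D e"

text \<open>
  Identifying \<open>u\<close> and \<open>v\<close>: the new vertex is named \<open>u\<close>. Every arc is kept, so an arc between
  \<open>u\<close> and \<open>v\<close> becomes a loop.
\<close>

definition identify :: "('a, 'b) pre_digraph \<Rightarrow> 'a \<Rightarrow> 'a \<Rightarrow> ('a, 'b) pre_digraph" where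
  "identify D u v =
     (let r = (\<lambda>w. if w = v then u else w)
      in \<lparr>verts = r ` verts D, arcs = arcs D, tail = r \<circ> tail D, head = r \<circ> head D\<rparr>)"

definition arc_contract :: "('a, 'b) pre_digraph \<Rightarrow> 'b \<Rightarrow> ('a, 'b) pre_digraph" where
  "arc_contract D e =
     (let u = tail D e; v = head D e
      in if u = v then pre_digraph.del_vert D u
         else identify (spanning_sub D {a \<in> arcs D. tail D a \<noteq> u \<and> head D a \<noteq> v}) u v)"

definition arc_extract :: "('a, 'b) pre_digraph \<Rightarrow> 'b \<Rightarrow> ('a, 'b) pre_digraph" where
  "arc_extract D e = pre_digraph.del_vert (pre_digraph.del_vert D (tail D e)) (head D e)"

end

theory Submission
  imports Defs
begin

text \<open>
  Both families of arc sets are described without components. Every component of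
  \<open>(V, F)\<close> is a cycle or an isolated vertex iff tail and head are injective on \<open>F\<close> and have
  the same image; the cycles are then the minimal nonempty \<^emph>\<open>balanced\<close> subsets of \<open>F\<close>, those on
  which tail and head have the same image. For paths the condition is that tail and head are
  injective and no nonempty subset is balanced; each path contributes exactly one vertex that is
  a tail but not a head. For a nonloop arc \<open>e\<close>, an arc set \<open>A\<close> of the contraction is balanced there
  iff \<open>A\<close> or \<open>A\<close> with \<open>e\<close> added is balanced in \<open>D\<close>. Hence, up
  to removing \<open>e\<close>, the arc sets of \<open>D\<close> that contain \<open>e\<close> are those of the contraction. The
  extraction of \<open>e\<close> accounts for the sets in which the merged vertex is isolated: they do not come
  from a cycle through \<open>e\<close>, and for paths they lack the component formed by \<open>e\<close> alone.
\<close>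

section \<open>Connectivity and components\<close>

text \<open>No arc crosses the boundary of \<open>S\<close>. Among sets of vertices these are the
  unions of vertex sets of weak components, so connectivity can be tested arc by arc, without
  walks.\<close>

definition cut_closed :: "('a, 'b) pre_digraph \<Rightarrow> 'a set \<Rightarrow> bool" where
  "cut_closed G S \<longleftrightarrow> (\<forall>a \<in> arcs G. tail G a \<in> S \<longleftrightarrow> head G a \<in> S)"

lemma cut_closedD:
  "cut_closed G S \<Longrightarrow> a \<in> arcs G \<Longrightarrow> tail G a \<in> S \<longleftrightarrow> head G a \<in> S"
  by (simp add: cut_closed_def)

text \<open>A cut-closed set is closed under steps of the symmetrized digraph, so it contains
  everything reachable from any of its members. Conversely, the set of vertices reachable from a
  given vertex is cut closed.\<close>

lemma connected_iff_cut:
  assumes "wf_digraph H"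
  shows "Digraph_Component.connected H \<longleftrightarrow>
    verts H \<noteq> {} \<and> (\<forall>S \<subseteq> verts H. S \<noteq> {} \<longrightarrow> cut_closed H S \<longrightarrow> S = verts H)"
proof -
  interpret H: wf_digraph H by fact
  interpret M: pair_wf_digraph "mk_symmetric H" by (rule H.wellformed_mk_symmetric)
  let ?R = "parcs (mk_symmetric H)"
  have reach: "u \<rightarrow>\<^sup>*\<^bsub>mk_symmetric H\<^esub> v \<longleftrightarrow> (u, v) \<in> ?R\<^sup>*" if "u \<in> verts H" for u v
    using M.reachable_conv'[of u v] that by simp
  have conn: "Digraph_Component.connected H \<longleftrightarrow>
      verts H \<noteq> {} \<and> (\<forall>u \<in> verts H. \<forall>v \<in> verts H. (u, v) \<in> ?R\<^sup>*)"
    by (auto simp: connected_def strongly_connected_def reach)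
  show ?thesis
  proof
    assume c: "Digraph_Component.connected H"
    have "S = verts H" if S: "S \<subseteq> verts H" "S \<noteq> {}" "cut_closed H S" for S
    proof
      show "verts H \<subseteq> S"
      proof
        fix v assume v: "v \<in> verts H"
        obtain s where s: "s \<in> S" using S by auto
        then have "(s, v) \<in> ?R\<^sup>*" using c conn S v by blast
        then show "v \<in> S"
          by (induct rule: rtrancl_induct)
            (use s S(3) in \<open>auto simp: parcs_mk_symmetric cut_closed_def\<close>)
      qed
    qed (use S in auto)
    then show "verts H \<noteq> {} \<and> (\<forall>S \<subseteq> verts H. S \<noteq> {} \<longrightarrow> cut_closed H S \<longrightarrow> S = verts H)"
      using c conn by auto
  next
    assume cut: "verts H \<noteq> {} \<and> (\<forall>S \<subseteq> verts H. S \<noteq> {} \<longrightarrow> cut_closed H S \<longrightarrow> S = verts H)"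
    have "(u, v) \<in> ?R\<^sup>*" if "u \<in> verts H" "v \<in> verts H" for u v
    proof -
      let ?S = "{w \<in> verts H. (u, w) \<in> ?R\<^sup>*}"
      have "cut_closed H ?S"
        by (auto simp: cut_closed_def parcs_mk_symmetric intro: rtrancl_into_rtrancl)
      then have "?S = verts H" using cut that(1) by (metis (no_types, lifting) empty_iff
            mem_Collect_eq rtrancl.rtrancl_refl subsetI)
      then show ?thesis using that(2) by blast
    qed
    then show "Digraph_Component.connected H" using cut conn by blast
  qed
qed

lemma connected_cutD:
  assumes "wf_digraph H" "Digraph_Component.connected H"
    and "S \<subseteq> verts H" "S \<noteq> {}" "cut_closed H S"
  shows "S = verts H"
  using assms connected_iff_cut by blast

lemma subgraph_tail_head:
  assumes "subgraph H G"
  shows "tail H = tail G" "head H = head G"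
  using assms by (auto simp: subgraph_def compatible_def)

text \<open>The component is built as the least cut-closed vertex set \<open>S\<close> containing
  \<open>v\<close>, with all arcs of \<open>G\<close> that start in \<open>S\<close>. Minimality
  yields connectivity.\<close>

lemma component_of_vertex:
  assumes wf: "wf_digraph G" and v: "v \<in> verts G"
  obtains H where "v \<in> verts H" "subgraph H G" "Digraph_Component.connected H"
    "cut_closed G (verts H)"
    "\<And>a. a \<in> arcs G \<Longrightarrow> tail G a \<in> verts H \<Longrightarrow> a \<in> arcs H"
proof -
  interpret G: wf_digraph G by fact
  define S where "S = \<Inter>{T. T \<subseteq> verts G \<and> v \<in> T \<and> cut_closed G T}"
  have "cut_closed G (verts G)" by (auto simp: cut_closed_def)
  with v have SG: "S \<subseteq> verts G" unfolding S_def by blast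
  have vS: "v \<in> S" unfolding S_def by blast
  have cS: "cut_closed G S" unfolding S_def cut_closed_def by blast
  have Smin: "S \<subseteq> T" if "T \<subseteq> verts G" "v \<in> T" "cut_closed G T" for T
    unfolding S_def using that by blast
  define H where "H = \<lparr>verts = S, arcs = {a \<in> arcs G. tail G a \<in> S},
    tail = tail G, head = head G\<rparr>"
  have wfH: "wf_digraph H"
    using cS by unfold_locales (auto simp: H_def cut_closed_def)
  have sub: "subgraph H G"
    using SG wfH wf by (auto simp: subgraph_def H_def compatible_def)
  have "T = verts H" if T: "T \<subseteq> verts H" "T \<noteq> {}" "cut_closed H T" for T
  proof -
    have TS: "T \<subseteq> S" using T by (simp add: H_def)
    have cT: "cut_closed G T"
      using T cS unfolding cut_closed_def H_def by auto
    have "S \<subseteq> T" if "v \<in> T" using Smin cT TS SG that by blast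
    \<comment> \<open>A cut-closed \<open>T\<close> that misses \<open>v\<close> leaves the
      cut-closed remainder \<open>S - T\<close> around \<open>v\<close>, so minimality of
      \<open>S\<close> makes \<open>T\<close> empty.\<close>
    moreover have "S \<subseteq> S - T" if "v \<notin> T"
    proof (rule Smin)
      show "cut_closed G (S - T)" using cT cS unfolding cut_closed_def by blast
    qed (use that vS SG in auto)
    ultimately show ?thesis using T TS by (auto simp: H_def)
  qed
  then have "Digraph_Component.connected H"
    using connected_iff_cut[OF wfH] vS by (auto simp: H_def)
  then show ?thesis using that[of H] sub vS cS by (simp add: H_def)
qed

text \<open>The trace of \<open>S\<close> on \<open>H\<close> is cut closed in \<open>H\<close>, and
  connectivity forces a nonempty trace to be everything.\<close>

lemma connected_subset_cut_closed:
  assumes "subgraph H G" "Digraph_Component.connected H" "cut_closed G S" "verts H \<inter> S \<noteq> {}"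
  shows "verts H \<subseteq> S"
proof -
  have wf: "wf_digraph H" using assms(1) by auto
  then interpret H: wf_digraph H .
  have "cut_closed H (verts H \<inter> S)"
  proof (unfold cut_closed_def, intro ballI)
    fix a assume a: "a \<in> arcs H"
    then have "a \<in> arcs G" using assms(1) by auto
    then show "tail H a \<in> verts H \<inter> S \<longleftrightarrow> head H a \<in> verts H \<inter> S"
      using H.wellformed[OF a] cut_closedD[OF assms(3)] subgraph_tail_head[OF assms(1)] by simp
  qed
  then have "verts H \<inter> S = verts H" using connected_cutD[OF wf assms(2)] assms(4) by blast
  then show ?thesis by blast
qed

text \<open>Replaces maximality among connected subgraphs by a local condition on single arcs. In
  one direction \<open>H\<close> lies inside the component built around one of its vertices and
  maximality makes them equal; in the other, \<open>verts H\<close> is cut closed in every larger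
  connected subgraph and hence exhausts it.\<close>

lemma components_iff:
  assumes wf: "wf_digraph G"
  shows "H \<in> components G \<longleftrightarrow> subgraph H G \<and> Digraph_Component.connected H \<and>
    (\<forall>a \<in> arcs G. tail G a \<in> verts H \<or> head G a \<in> verts H \<longrightarrow> a \<in> arcs H)"
    (is "_ \<longleftrightarrow> ?R")
proof
  assume "H \<in> components G"
  then have sub: "subgraph H G" and c: "Digraph_Component.connected H"
    and max: "\<And>H'. subgraph H H' \<Longrightarrow> subgraph H' G \<Longrightarrow> Digraph_Component.connected H' \<Longrightarrow> H' = H"
    by (auto simp: components_def pre_digraph.max_subgraph_def)
  interpret H: wf_digraph H using sub by auto
  note th = subgraph_tail_head[OF sub]
  obtain v where v: "v \<in> verts H" using c connected_iff_cut[OF H.wf_digraph] by auto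
  then have "v \<in> verts G" using sub by auto
  then obtain K where K: "v \<in> verts K" "subgraph K G" "Digraph_Component.connected K"
    "cut_closed G (verts K)" and inK: "\<And>a. a \<in> arcs G \<Longrightarrow> tail G a \<in> verts K \<Longrightarrow> a \<in> arcs K"
    using component_of_vertex[OF wf] by metis
  have HK: "verts H \<subseteq> verts K"
    using connected_subset_cut_closed[OF sub c K(4)] K(1) v by blast
  have wfK: "wf_digraph K" using K(2) by auto
  have "arcs H \<subseteq> arcs K"
    using inK HK sub th H.tail_in_verts by (metis subgraphE subset_iff)
  then have "subgraph H K"
    using HK th subgraph_tail_head[OF K(2)] wfK H.wf_digraph
    by (auto simp: subgraph_def compatible_def)
  then have "K = H" using max K by blast
  then show ?R using sub c inK K(4) by (auto simp: cut_closed_def)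
next
  assume R: ?R
  then interpret H: wf_digraph H by auto
  have th: "tail H = tail G" "head H = head G" using R subgraph_tail_head by blast+
  have "H' = H" if H': "subgraph H H'" "subgraph H' G" "Digraph_Component.connected H'" for H'
  proof -
    have wf': "wf_digraph H'" using H' by auto
    have "cut_closed H' (verts H)"
      using R H'(2) subgraph_tail_head[OF H'(2)] H.wellformed th
      unfolding cut_closed_def by (metis subgraphE subsetD)
    moreover have "verts H \<noteq> {}" using R connected_iff_cut[OF H.wf_digraph] by blast
    moreover have "verts H \<subseteq> verts H'" using H' by auto
    ultimately have v: "verts H = verts H'" using connected_cutD[OF wf' H'(3)] by blast
    have "arcs H' \<subseteq> arcs H"
      using R H'(2) v wf' subgraph_tail_head[OF H'(2)] wf_digraph.tail_in_verts
      by (metis subgraphE subset_iff)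
    moreover have "arcs H \<subseteq> arcs H'" using H'(1) by auto
    ultimately show ?thesis using v th subgraph_tail_head[OF H'(2)] by simp
  qed
  then show "H \<in> components G"
    using R by (auto simp: components_def pre_digraph.max_subgraph_def)
qed

lemma componentD:
  assumes "wf_digraph G" "H \<in> components G"
  shows "wf_digraph H" "Digraph_Component.connected H" "verts H \<subseteq> verts G" "arcs H \<subseteq> arcs G"
    "tail H = tail G" "head H = head G" "cut_closed G (verts H)"
    "\<And>a. a \<in> arcs G \<Longrightarrow> tail G a \<in> verts H \<Longrightarrow> a \<in> arcs H"
    "\<And>a. a \<in> arcs G \<Longrightarrow> head G a \<in> verts H \<Longrightarrow> a \<in> arcs H"
proof -
  have R: "subgraph H G" "Digraph_Component.connected H"
    "\<forall>a \<in> arcs G. tail G a \<in> verts H \<or> head G a \<in> verts H \<longrightarrow> a \<in> arcs H"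
    using assms components_iff by blast+
  show wf: "wf_digraph H" and th: "tail H = tail G" "head H = head G"
    using R subgraph_tail_head by auto
  show "Digraph_Component.connected H" "verts H \<subseteq> verts G" "arcs H \<subseteq> arcs G"
    and "\<And>a. a \<in> arcs G \<Longrightarrow> tail G a \<in> verts H \<Longrightarrow> a \<in> arcs H"
    "\<And>a. a \<in> arcs G \<Longrightarrow> head G a \<in> verts H \<Longrightarrow> a \<in> arcs H"
    using R by auto
  show "cut_closed G (verts H)"
    using R(3) wf_digraph.wellformed[OF wf] th unfolding cut_closed_def by metis
qed

lemma component_exists:
  assumes "wf_digraph G" "v \<in> verts G"
  obtains H where "H \<in> components G" "v \<in> verts H"
proof -
  obtain H where "v \<in> verts H" "subgraph H G" "Digraph_Component.connected H"
    "cut_closed G (verts H)" "\<And>a. a \<in> arcs G \<Longrightarrow> tail G a \<in> verts H \<Longrightarrow> a \<in> arcs H"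
    using component_of_vertex[OF assms] by metis
  then show ?thesis
    using that[of H] components_iff[OF assms(1)] by (auto simp: cut_closed_def)
qed

text \<open>Components that meet have the same vertices, because each vertex set is cut closed, and
  the vertices determine the arcs.\<close>

lemma component_unique:
  assumes wf: "wf_digraph G" and H: "H \<in> components G" and K: "K \<in> components G"
    and v: "v \<in> verts H" "v \<in> verts K"
  shows "H = K"
proof -
  have "verts A \<subseteq> verts B" if "A \<in> components G" "B \<in> components G" "v \<in> verts A" "v \<in> verts B" for A B
    using connected_subset_cut_closed[of A G "verts B"] that components_iff[OF wf]
      componentD(7)[OF wf that(2)] by blast
  then have V: "verts H = verts K" using H K v by blast
  have "arcs A \<subseteq> arcs B" if "A \<in> components G" "B \<in> components G" "verts A = verts B" for A B
    using componentD[OF wf that(1)] componentD(8)[OF wf that(2)] that(3)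
    by (metis subset_iff wf_digraph.tail_in_verts)
  then have "arcs H = arcs K" using H K V by blast
  then show ?thesis using V componentD(5,6)[OF wf H] componentD(5,6)[OF wf K] by simp
qed

section \<open>Balanced arc sets\<close>

text \<open>Formulated for bare tail and head maps because contraction changes these maps while the
  arcs keep their names. The empty set is balanced, hence the separate treatment of it in the
  definitions that follow.\<close>

definition balanced :: "('b \<Rightarrow> 'a) \<Rightarrow> ('b \<Rightarrow> 'a) \<Rightarrow> 'b set \<Rightarrow> bool" where
  "balanced t h A \<longleftrightarrow> t ` A = h ` A"

definition min_balanced :: "('b \<Rightarrow> 'a) \<Rightarrow> ('b \<Rightarrow> 'a) \<Rightarrow> 'b set \<Rightarrow> 'b set \<Rightarrow> bool" where
  "min_balanced t h F A \<longleftrightarrow> A \<subseteq> F \<and> A \<noteq> {} \<and> balanced t h A \<and>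
     (\<forall>B \<subseteq> A. B \<noteq> {} \<longrightarrow> balanced t h B \<longrightarrow> B = A)"

definition cyclic_arcs :: "('b \<Rightarrow> 'a) \<Rightarrow> ('b \<Rightarrow> 'a) \<Rightarrow> 'b set \<Rightarrow> bool" where
  "cyclic_arcs t h F \<longleftrightarrow> inj_on t F \<and> inj_on h F \<and> balanced t h F"

definition linear_arcs :: "('b \<Rightarrow> 'a) \<Rightarrow> ('b \<Rightarrow> 'a) \<Rightarrow> 'b set \<Rightarrow> bool" where
  "linear_arcs t h F \<longleftrightarrow> inj_on t F \<and> inj_on h F \<and>
     (\<forall>A \<subseteq> F. balanced t h A \<longrightarrow> A = {})"

section \<open>Arc sets of directed cycles and directed paths\<close>

lemma cas_awalk_verts:
  assumes "pre_digraph.cas H u p v"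
  shows "pre_digraph.awalk_verts H u p = u # map (head H) p"
    and "pre_digraph.awalk_verts H u p = map (tail H) p @ [v]"
  using assms
  by (induct p arbitrary: u) (auto simp: pre_digraph.awalk_verts.simps pre_digraph.cas.simps)

text \<open>Reading the vertex list of the closed walk once by heads and once by tails shows that
  both give the same multiset, so distinctness of the heads passes to the tails.\<close>

lemma directed_cycle_cyclic_arcs:
  assumes "is_directed_cycle H"
  shows "arcs H \<noteq> {}" "cyclic_arcs (tail H) (head H) (arcs H)"
proof -
  obtain p u where cas: "pre_digraph.cas H u p u"
    and d: "distinct (tl (pre_digraph.awalk_verts H u p))" and p: "p \<noteq> []" "arcs H = set p"
    using assms by (auto simp: is_directed_cycle_def pre_digraph.cycle_def pre_digraph.awalk_def)
  have eq: "u # map (head H) p = map (tail H) p @ [u]"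
    using cas_awalk_verts[OF cas] by simp
  have dh: "distinct (map (head H) p)"
    using d cas_awalk_verts(1)[OF cas] by simp
  have m: "mset (map (head H) p) = mset (map (tail H) p)"
    using arg_cong[OF eq, of mset] by simp
  then have dt: "distinct (map (tail H) p)" using dh mset_eq_imp_distinct_iff by blast
  have s: "tail H ` set p = head H ` set p" using mset_eq_setD[OF m] by simp
  show "arcs H \<noteq> {}" using p by auto
  show "cyclic_arcs (tail H) (head H) (arcs H)"
    using dh dt s p(2) by (simp add: cyclic_arcs_def balanced_def distinct_map)
qed

text \<open>The tail of the first arc is no head on the path, so that arc lies in no balanced
  subset. Removing it leaves a shorter path, and induction disposes of the remaining arcs.\<close>

lemma apath_linear_arcs:
  assumes "pre_digraph.apath H u p v"
  shows "linear_arcs (tail H) (head H) (set p)"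
proof -
  have cas: "pre_digraph.cas H u p v" and d: "distinct (pre_digraph.awalk_verts H u p)"
    using assms by (auto simp: pre_digraph.apath_def pre_digraph.awalk_def)
  have "distinct (u # map (head H) p)" "distinct (map (tail H) p @ [v])"
    using d cas_awalk_verts[OF cas] by metis+
  then have inj: "inj_on (tail H) (set p)" "inj_on (head H) (set p)"
    by (simp_all add: distinct_map)
  have "A = {}" if "A \<subseteq> set p" "balanced (tail H) (head H) A" for A
    using cas d that(1)
  proof (induct p arbitrary: u)
    case (Cons e es)
    have cas': "pre_digraph.cas H (head H e) es v" and u: "tail H e = u"
      using Cons.prems(1) by (simp_all add: pre_digraph.cas.simps)
    have d': "distinct (u # head H e # map (head H) es)"
      using Cons.prems(2) cas_awalk_verts(1)[OF Cons.prems(1)] by simp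
    have "tail H e \<notin> head H ` A" using Cons.prems(3) d' u by auto
    then have "e \<notin> A" using that(2) unfolding balanced_def by blast
    then show ?case
      using Cons.hyps[OF cas'] Cons.prems(3) d' cas_awalk_verts(1)[OF cas'] by auto
  qed simp
  then show ?thesis using inj by (simp add: linear_arcs_def)
qed

text \<open>The start of a path will represent it when paths are counted. The two readings of the
  vertex list give the same set, \<open>u\<close> is not a head, and \<open>v\<close> is
  one.\<close>

lemma apath_source:
  assumes "pre_digraph.apath H u p v" "p \<noteq> []"
  shows "tail H ` set p - head H ` set p = {u}"
proof -
  have cas: "pre_digraph.cas H u p v" and d: "distinct (pre_digraph.awalk_verts H u p)"
    using assms(1) by (auto simp: pre_digraph.apath_def pre_digraph.awalk_def)
  have eq: "u # map (head H) p = map (tail H) p @ [v]"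
    using cas_awalk_verts[OF cas] by simp
  have "distinct (u # map (head H) p)" using d cas_awalk_verts(1)[OF cas] by simp
  then have u: "u \<notin> head H ` set p" by simp
  have "v \<in> head H ` set p"
    using arg_cong[OF eq, of last] assms(2) by (metis last_ConsR last_in_set last_snoc
        list.map_disc_iff list.set_map)
  moreover have "insert u (head H ` set p) = insert v (tail H ` set p)"
    using arg_cong[OF eq, of set] by simp
  ultimately show ?thesis using u by blast
qed

lemma directed_path_linear_arcs:
  assumes "is_directed_path H"
  shows "arcs H \<noteq> {}" "linear_arcs (tail H) (head H) (arcs H)"
    "\<exists>s. tail H ` arcs H - head H ` arcs H = {s}"
proof -
  obtain u p v where p: "pre_digraph.apath H u p v" "p \<noteq> []" "arcs H = set p"
    using assms by (auto simp: is_directed_path_def)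
  show "arcs H \<noteq> {}" using p by simp
  show "linear_arcs (tail H) (head H) (arcs H)" using apath_linear_arcs[OF p(1)] p(3) by simp
  show "\<exists>s. tail H ` arcs H - head H ` arcs H = {s}" using apath_source[OF p(1,2)] p(3) by simp
qed

text \<open>
  A path of maximal length can only be extended by an arc closing it up to a cycle, and degrees
  at most one prevent any other arc from touching it.
\<close>

lemma connected_inj_cases:
  assumes fin: "fin_digraph H" and conn: "Digraph_Component.connected H"
    and inj: "inj_on (tail H) (arcs H)" "inj_on (head H) (arcs H)"
  shows "is_directed_cycle H \<or> is_directed_path H \<or> is_isolated_vertex H"
proof -
  interpret fin_digraph H by fact
  have wf: "wf_digraph H" by (rule wf_digraph)
  have "verts H \<noteq> {}" using conn connected_iff_cut[OF wf] by auto
  then obtain w where "w \<in> verts H" by auto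
  then have ex: "\<exists>u v. apath u [] v" by (auto simp: apath_Nil_iff)
  let ?P = "\<lambda>p. \<exists>u v. apath u p v"
  \<comment> \<open>A path has distinct vertices and one vertex more than arcs; this bounds its
    length, so a longest path exists.\<close>
  have bound: "length p < card (verts H) + 1" if "?P p" for p
  proof -
    from that obtain u v where "apath u p v" by auto
    then have "set (awalk_verts u p) \<subseteq> verts H" "distinct (awalk_verts u p)"
      by (auto simp: apath_def)
    then have "card (set (awalk_verts u p)) \<le> card (verts H)"
      and "card (set (awalk_verts u p)) = length (awalk_verts u p)"
      by (blast intro: card_mono finite_verts, blast intro: distinct_card)
    then show ?thesis using length_awalk_verts[of u p] by linarith
  qed
  obtain p where p: "?P p" and max: "\<And>q. ?P q \<Longrightarrow> length q \<le> length p"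
    using ex_has_greatest_nat[of ?P "[]" length "card (verts H) + 1"] ex bound by blast
  from p obtain u v where ap: "apath u p v" by (elim exE)
  then have aw: "awalk u p v" and d: "distinct (awalk_verts u p)" by (auto simp: apath_def)
  have sp: "set p \<subseteq> arcs H" and cas: "cas u p v" using aw by (auto simp: awalk_def)
  note vs = cas_awalk_verts[OF cas]
  have sv: "set (awalk_verts u p) \<subseteq> verts H" using aw by auto
  have wh: "set (awalk_verts u p) = insert u (head H ` set p)" using vs(1) by simp
  have wt: "set (awalk_verts u p) = insert v (tail H ` set p)" using vs(2) by simp
  have "distinct (u # map (head H) p)" using d vs(1) by simp
  then have uh: "u \<notin> head H ` set p" and dh: "distinct (map (head H) p)" by simp_all
  \<comment> \<open>An arc off \<open>p\<close> shares no tail and no head with an arc of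
    \<open>p\<close>. If it leaves \<open>v\<close> without entering \<open>u\<close>, it extends
    the path at the end. If it does not leave \<open>v\<close>, its tail is off the path, so it
    enters \<open>u\<close> and extends the path at the front.\<close>
  have touch: "a \<in> set p \<or> (tail H a = v \<and> head H a = u)"
    if a: "a \<in> arcs H" "tail H a \<in> set (awalk_verts u p) \<or> head H a \<in> set (awalk_verts u p)" for a
  proof (rule ccontr)
    assume n: "\<not> ?thesis"
    have nt: "tail H a \<notin> tail H ` set p" using n inj(1) a(1) sp by (auto dest: inj_onD)
    have nh: "head H a \<notin> head H ` set p" using n inj(2) a(1) sp by (auto dest: inj_onD)
    show False
    proof (cases "tail H a = v")
      case True
      then have "head H a \<notin> set (awalk_verts u p)" using n nh wh by auto
      moreover have "v \<in> set (awalk_verts u p)" by (simp add: wt)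
      ultimately have "head H a \<notin> set (awalk_verts u p)" "v \<noteq> head H a" by auto
      then have "apath u (p @ [a]) (head H a)"
        using ap aw a(1) True by (simp add: apath_append_iff apath_Cons_iff apath_Nil_iff)
      then show False using max[of "p @ [a]"] by auto
    next
      case False
      then have t: "tail H a \<notin> set (awalk_verts u p)" using nt wt by auto
      then have "head H a = u" using a nh wh by auto
      then have "apath (tail H a) (a # p) v"
        using ap a t by (auto simp: apath_Cons_iff)
      then show False using max[of "a # p"] by auto
    qed
  qed
  have V: "verts H = set (awalk_verts u p)"
  proof -
    have "cut_closed H (set (awalk_verts u p))"
    proof (unfold cut_closed_def, intro ballI)
      fix a assume "a \<in> arcs H"
      note touch = touch[OF this]
      have "u \<in> set (awalk_verts u p)" by (simp add: wh)
      moreover have "v \<in> set (awalk_verts u p)" by (simp add: wt)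
      moreover have "head H a \<in> set (awalk_verts u p)" if "a \<in> set p"
        by (simp add: wh that)
      moreover have "tail H a \<in> set (awalk_verts u p)" if "a \<in> set p"
        by (simp add: wt that)
      ultimately show "tail H a \<in> set (awalk_verts u p) \<longleftrightarrow> head H a \<in> set (awalk_verts u p)"
        using touch by metis
    qed
    then show ?thesis using connected_cutD[OF wf conn sv] awalk_verts_non_Nil by auto
  qed
  have all_touch: "a \<in> set p \<or> (tail H a = v \<and> head H a = u)" if "a \<in> arcs H" for a
    using touch[OF that] tail_in_verts[OF that] unfolding V by blast
  show ?thesis
  \<comment> \<open>An arc from \<open>v\<close> to \<open>u\<close> is unique by injectivity of the
    tail map and closes the path to a cycle; for empty \<open>p\<close> it is a loop.\<close>
  proof (cases "\<exists>a \<in> arcs H. tail H a = v \<and> head H a = u")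
    case True
    then obtain a where a: "a \<in> arcs H" "tail H a = v" "head H a = u" by blast
    have "arcs H = set (p @ [a])"
    proof
      show "arcs H \<subseteq> set (p @ [a])"
      proof
        fix b assume b: "b \<in> arcs H"
        from all_touch[OF b] show "b \<in> set (p @ [a])"
        proof
          assume "tail H b = v \<and> head H b = u"
          then have "b = a" using inj_onD[OF inj(1)] a b by metis
          then show ?thesis by simp
        qed simp
      qed
    qed (use sp a in auto)
    moreover have "cycle (p @ [a])"
    proof -
      have w: "awalk u (p @ [a]) u"
        by (rule awalk_appendI[OF aw]) (use arc_implies_awalk[OF a(1)] a in simp)
      then have "cas u (p @ [a]) u" by (simp add: awalk_def)
      then have "awalk_verts u (p @ [a]) = u # map (head H) (p @ [a])"
        by (rule cas_awalk_verts)
      moreover have "distinct (map (head H) (p @ [a]))"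
        using dh uh a by auto
      ultimately show ?thesis using w unfolding cycle_def by auto
    qed
    moreover have "verts H = tail H ` set (p @ [a])" using a(2) by (simp add: V wt)
    ultimately show ?thesis unfolding is_directed_cycle_def by blast
  next
    case False
    then have "arcs H \<subseteq> set p" using all_touch by blast
    with sp have A: "arcs H = set p" by blast
    show ?thesis
    proof (cases "p = []")
      case True
      then show ?thesis using A V by (auto simp: is_isolated_vertex_def)
    next
      case False
      then show ?thesis using A V ap by (auto simp: is_directed_path_def)
    qed
  qed
qed

section \<open>Component-free form of the polynomials\<close>

text \<open>By injectivity no arc outside \<open>A\<close> has an end in the common image of
  \<open>A\<close>. This image is therefore cut closed, hence consists of all vertices, and no arc
  is left outside \<open>A\<close>.\<close>

lemma balanced_connected:
  assumes wf: "wf_digraph H" and conn: "Digraph_Component.connected H"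
    and inj: "inj_on (tail H) (arcs H)" "inj_on (head H) (arcs H)"
    and A: "A \<subseteq> arcs H" "A \<noteq> {}" "balanced (tail H) (head H) A"
  shows "A = arcs H"
proof -
  interpret wf_digraph H by fact
  have b: "tail H ` A = head H ` A" using A(3) by (simp add: balanced_def)
  have mem: "tail H a \<in> tail H ` A \<longleftrightarrow> a \<in> A" "head H a \<in> tail H ` A \<longleftrightarrow> a \<in> A"
    if "a \<in> arcs H" for a
    using inj_on_image_mem_iff[OF inj(1) that A(1)] inj_on_image_mem_iff[OF inj(2) that A(1)] b
    by simp_all
  have "cut_closed H (tail H ` A)" using mem by (simp add: cut_closed_def)
  moreover have "tail H ` A \<subseteq> verts H" using A(1) tail_in_verts by auto
  ultimately have V: "tail H ` A = verts H"
    using connected_cutD[OF wf conn] A(2) by simp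
  have "a \<in> A" if "a \<in> arcs H" for a
    using mem(1)[OF that] tail_in_verts[OF that] V by simp
  then show ?thesis using A(1) by blast
qed

section \<open>Restricting arc sets to components\<close>

context fin_digraph
begin

lemma component_arc_iff:
  assumes "H \<in> components G" "a \<in> arcs G"
  shows "a \<in> arcs H \<longleftrightarrow> tail G a \<in> verts H" "a \<in> arcs H \<longleftrightarrow> head G a \<in> verts H"
proof -
  note c = componentD[OF wf_digraph assms(1)]
  show "a \<in> arcs H \<longleftrightarrow> tail G a \<in> verts H"
    using wf_digraph.tail_in_verts[OF c(1)] c(8)[OF assms(2)] by (auto simp: c(5))
  show "a \<in> arcs H \<longleftrightarrow> head G a \<in> verts H"
    using wf_digraph.head_in_verts[OF c(1)] c(9)[OF assms(2)] by (auto simp: c(6))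
qed

text \<open>An arc belongs to a component iff its tail does, and iff its head does. Both images
  therefore restrict in the same way, and balance is inherited by each component.\<close>

lemma component_image:
  assumes "H \<in> components G" "A \<subseteq> arcs G"
  shows "tail G ` (A \<inter> arcs H) = tail G ` A \<inter> verts H"
    "head G ` (A \<inter> arcs H) = head G ` A \<inter> verts H"
proof -
  have "A \<inter> arcs H = {a \<in> A. tail G a \<in> verts H}" "A \<inter> arcs H = {a \<in> A. head G a \<in> verts H}"
    using component_arc_iff[OF assms(1)] assms(2) by (simp_all add: set_eq_iff subset_iff) metis+
  then show "tail G ` (A \<inter> arcs H) = tail G ` A \<inter> verts H"
    "head G ` (A \<inter> arcs H) = head G ` A \<inter> verts H"
    by auto
qed

lemma balanced_Int_component:
  assumes "H \<in> components G" "A \<subseteq> arcs G" "balanced (tail G) (head G) A"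
  shows "balanced (tail G) (head G) (A \<inter> arcs H)"
  using assms(3) by (simp add: balanced_def component_image[OF assms(1,2)])

lemma component_of_arc:
  assumes "a \<in> arcs G"
  obtains H where "H \<in> components G" "a \<in> arcs H"
proof -
  obtain H where "H \<in> components G" "tail G a \<in> verts H"
    using component_exists[OF wf_digraph tail_in_verts[OF assms]] .
  then show ?thesis using that[of H] component_arc_iff(1)[of H a] assms by simp
qed

lemma component_eqI:
  assumes "H \<in> components G" "K \<in> components G" "a \<in> arcs H" "a \<in> arcs K"
  shows "H = K"
proof (rule component_unique[OF wf_digraph assms(1,2)])
  have "a \<in> arcs G" using componentD(4)[OF wf_digraph assms(1)] assms(3) by blast
  then show "tail G a \<in> verts H" "tail G a \<in> verts K"
    using component_arc_iff(1) assms by blast+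
qed

lemma component_fin_digraph: "H \<in> components G \<Longrightarrow> fin_digraph H"
  using components_iff[OF wf_digraph] fin_digraph_subgraph by blast

text \<open>Arcs with a common tail or a common head lie in the same component, so injectivity can
  be checked there.\<close>

lemma inj_on_components:
  assumes "\<And>H. H \<in> components G \<Longrightarrow> inj_on (tail G) (arcs H) \<and> inj_on (head G) (arcs H)"
  shows "inj_on (tail G) (arcs G)" "inj_on (head G) (arcs G)"
proof -
  have "x = y" if xy: "x \<in> arcs G" "y \<in> arcs G" "tail G x = tail G y \<or> head G x = head G y" for x y
  proof -
    obtain H where H: "H \<in> components G" "x \<in> arcs H" using component_of_arc[OF xy(1)] .
    have "y \<in> arcs H"
      using xy(3) H(2) component_arc_iff[OF H(1) xy(1)] component_arc_iff[OF H(1) xy(2)] by auto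
    with H(2) xy(3) show ?thesis
      using inj_onD[OF conjunct1[OF assms[OF H(1)]]] inj_onD[OF conjunct2[OF assms[OF H(1)]]]
      by blast
  qed
  then show "inj_on (tail G) (arcs G)" "inj_on (head G) (arcs G)" by (blast intro: inj_onI)+
qed

lemma component_cases:
  assumes "inj_on (tail G) (arcs G)" "inj_on (head G) (arcs G)" "H \<in> components G"
  shows "is_directed_cycle H \<or> is_directed_path H \<or> is_isolated_vertex H"
proof (rule connected_inj_cases)
  note c = componentD[OF wf_digraph assms(3)]
  show "fin_digraph H" by (rule component_fin_digraph[OF assms(3)])
  show "Digraph_Component.connected H" by (rule c(2))
  show "inj_on (tail H) (arcs H)" "inj_on (head H) (arcs H)"
    using inj_on_subset[OF assms(1) c(4)] inj_on_subset[OF assms(2) c(4)]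
    by (simp_all add: c(5,6))
qed

text \<open>From left to right the properties are collected from the components. From right to left
  the arcs of each component are balanced, which excludes a path, and the trichotomy leaves a cycle
  or an isolated vertex.\<close>

lemma components_cycle_iff:
  "(\<forall>H \<in> components G. is_directed_cycle H \<or> is_isolated_vertex H) \<longleftrightarrow>
     cyclic_arcs (tail G) (head G) (arcs G)"
proof
  assume H: "\<forall>H \<in> components G. is_directed_cycle H \<or> is_isolated_vertex H"
  have cyc: "cyclic_arcs (tail G) (head G) (arcs H)" if "H \<in> components G" for H
  proof -
    from H that consider "is_directed_cycle H" | "is_isolated_vertex H" by blast
    then show ?thesis
    proof cases
      case 1
      then show ?thesis
        using directed_cycle_cyclic_arcs(2)[of H] componentD(5,6)[OF wf_digraph that] by simp
    next
      case 2
      then show ?thesis by (simp add: is_isolated_vertex_def cyclic_arcs_def balanced_def)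
    qed
  qed
  have inj: "inj_on (tail G) (arcs G)" "inj_on (head G) (arcs G)"
    by (rule inj_on_components; use cyc in \<open>simp add: cyclic_arcs_def\<close>)+
  have "tail G a \<in> head G ` arcs G \<and> head G a \<in> tail G ` arcs G" if a: "a \<in> arcs G" for a
  proof -
    obtain H where H: "H \<in> components G" "a \<in> arcs H" using component_of_arc[OF a] .
    have eq: "tail G ` arcs H = head G ` arcs H"
      using cyc[OF H(1)] by (simp add: cyclic_arcs_def balanced_def)
    have "tail G a \<in> head G ` arcs H" "head G a \<in> tail G ` arcs H"
      using H(2) by (simp add: eq[symmetric], simp add: eq)
    then show ?thesis using componentD(4)[OF wf_digraph H(1)] by blast
  qed
  then show "cyclic_arcs (tail G) (head G) (arcs G)"
    using inj by (auto simp: cyclic_arcs_def balanced_def)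
next
  assume c: "cyclic_arcs (tail G) (head G) (arcs G)"
  show "\<forall>H \<in> components G. is_directed_cycle H \<or> is_isolated_vertex H"
  proof
    fix H assume H: "H \<in> components G"
    note cd = componentD[OF wf_digraph H]
    have "\<not> is_directed_path H"
    proof
      assume p: "is_directed_path H"
      have "balanced (tail G) (head G) (arcs G \<inter> arcs H)"
        using balanced_Int_component[OF H, of "arcs G"] c by (simp add: cyclic_arcs_def)
      then have "balanced (tail G) (head G) (arcs H)" using cd(4) by (simp add: Int_absorb1)
      then show False using directed_path_linear_arcs(1,2)[OF p] cd(5,6)
        by (auto simp: linear_arcs_def)
    qed
    then show "is_directed_cycle H \<or> is_isolated_vertex H"
      using component_cases[OF _ _ H] c by (auto simp: cyclic_arcs_def)
  qed
qed

text \<open>A nonempty balanced set would meet some component in a nonempty balanced set.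
  Conversely, the arcs of a cycle component would form such a set.\<close>

lemma components_path_iff:
  "(\<forall>H \<in> components G. is_directed_path H \<or> is_isolated_vertex H) \<longleftrightarrow>
     linear_arcs (tail G) (head G) (arcs G)"
proof
  assume H: "\<forall>H \<in> components G. is_directed_path H \<or> is_isolated_vertex H"
  have lin: "linear_arcs (tail G) (head G) (arcs H)" if "H \<in> components G" for H
  proof -
    from H that consider "is_directed_path H" | "is_isolated_vertex H" by blast
    then show ?thesis
    proof cases
      case 1
      then show ?thesis
        using directed_path_linear_arcs(2)[of H] componentD(5,6)[OF wf_digraph that] by simp
    next
      case 2
      then show ?thesis by (simp add: is_isolated_vertex_def linear_arcs_def)
    qed
  qed
  have inj: "inj_on (tail G) (arcs G)" "inj_on (head G) (arcs G)"
    by (rule inj_on_components; use lin in \<open>simp add: linear_arcs_def\<close>)+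
  have "A = {}" if A: "A \<subseteq> arcs G" "balanced (tail G) (head G) A" for A
  proof (rule ccontr)
    assume "A \<noteq> {}"
    then obtain a where a: "a \<in> A" by blast
    then obtain H where H: "H \<in> components G" "a \<in> arcs H" using component_of_arc A(1) by blast
    then have "A \<inter> arcs H = {}"
      using balanced_Int_component[OF H(1) A] lin[OF H(1)] by (simp add: linear_arcs_def)
    then show False using a H(2) by blast
  qed
  then show "linear_arcs (tail G) (head G) (arcs G)"
    using inj by (simp add: linear_arcs_def)
next
  assume c: "linear_arcs (tail G) (head G) (arcs G)"
  show "\<forall>H \<in> components G. is_directed_path H \<or> is_isolated_vertex H"
  proof
    fix H assume H: "H \<in> components G"
    note cd = componentD[OF wf_digraph H]
    have "\<not> is_directed_cycle H"
    proof
      assume p: "is_directed_cycle H"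
      then have "balanced (tail G) (head G) (arcs H)"
        using directed_cycle_cyclic_arcs(2)[OF p] cd(5,6) by (simp add: cyclic_arcs_def)
      then show False using directed_cycle_cyclic_arcs(1)[OF p] cd(4) c
        by (auto simp: linear_arcs_def)
    qed
    then show "is_directed_path H \<or> is_isolated_vertex H"
      using component_cases[OF _ _ H] c by (auto simp: linear_arcs_def)
  qed
qed

text \<open>A cycle component is matched with its arc set. Minimality confines a minimal balanced
  set to one component, as its intersection with a component is again balanced, and there no
  nonempty proper subset of the arcs is balanced.\<close>

lemma kc_eq:
  assumes "cyclic_arcs (tail G) (head G) (arcs G)"
  shows "kc G = card {A. min_balanced (tail G) (head G) (arcs G) A}"
proof -
  have inj: "inj_on (tail G) (arcs G)" "inj_on (head G) (arcs G)"
    using assms by (auto simp: cyclic_arcs_def)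
  have whole: "A = arcs H"
    if "H \<in> components G" "A \<subseteq> arcs H" "A \<noteq> {}" "balanced (tail G) (head G) A" for A H
  proof (rule balanced_connected)
    note c = componentD[OF wf_digraph that(1)]
    show "wf_digraph H" "Digraph_Component.connected H" by (rule c)+
    show "inj_on (tail H) (arcs H)" "inj_on (head H) (arcs H)"
      using inj_on_subset[OF inj(1) c(4)] inj_on_subset[OF inj(2) c(4)] by (simp_all add: c(5,6))
  qed (use that componentD(5,6)[OF wf_digraph that(1)] in simp_all)
  have "bij_betw arcs {H \<in> components G. is_directed_cycle H}
      {A. min_balanced (tail G) (head G) (arcs G) A}"
  proof (rule bij_betwI')
    fix H K assume "H \<in> {H \<in> components G. is_directed_cycle H}"
      "K \<in> {H \<in> components G. is_directed_cycle H}"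
    then have H: "H \<in> components G" "is_directed_cycle H" and K: "K \<in> components G" by auto
    obtain a where "a \<in> arcs H" using directed_cycle_cyclic_arcs(1)[OF H(2)] by blast
    then show "arcs H = arcs K \<longleftrightarrow> H = K"
      using component_eqI[OF H(1) K, of a] by auto
  next
    fix H assume "H \<in> {H \<in> components G. is_directed_cycle H}"
    then have H: "H \<in> components G" "is_directed_cycle H" by auto
    note c = componentD[OF wf_digraph H(1)]
    have "balanced (tail G) (head G) (arcs H)"
      using directed_cycle_cyclic_arcs(2)[OF H(2)] c(5,6) by (simp add: cyclic_arcs_def)
    moreover have "\<forall>B \<subseteq> arcs H. B \<noteq> {} \<longrightarrow> balanced (tail G) (head G) B \<longrightarrow> B = arcs H"
      using whole[OF H(1)] by blast
    ultimately show "arcs H \<in> {A. min_balanced (tail G) (head G) (arcs G) A}"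
      using c(4) directed_cycle_cyclic_arcs(1)[OF H(2)] by (simp add: min_balanced_def)
  next
    fix A assume "A \<in> {A. min_balanced (tail G) (head G) (arcs G) A}"
    then have A: "A \<subseteq> arcs G" "A \<noteq> {}" "balanced (tail G) (head G) A"
      and min: "\<And>B. B \<subseteq> A \<Longrightarrow> B \<noteq> {} \<Longrightarrow> balanced (tail G) (head G) B \<Longrightarrow> B = A"
      by (auto simp: min_balanced_def)
    obtain a where a: "a \<in> A" using A(2) by blast
    then obtain H where H: "H \<in> components G" "a \<in> arcs H" using component_of_arc A(1) by blast
    have "A \<inter> arcs H = A"
      by (rule min) (use balanced_Int_component[OF H(1) A(1,3)] a H(2) in auto)
    then have "A = arcs H" using whole[OF H(1) _ A(2,3)] by blast
    moreover have "is_directed_cycle H"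
    proof -
      have "is_directed_cycle H \<or> is_isolated_vertex H"
        using components_cycle_iff assms H(1) by blast
      then show ?thesis using H(2) by (auto simp: is_isolated_vertex_def)
    qed
    ultimately show "\<exists>H \<in> {H \<in> components G. is_directed_cycle H}. A = arcs H"
      using H(1) by blast
  qed
  then show ?thesis unfolding kc_def by (rule bij_betw_same_card)
qed

text \<open>Each path component is matched with its unique source; the sources inside a component
  are the sources of \<open>G\<close> among its vertices.\<close>

lemma kp_eq:
  assumes "linear_arcs (tail G) (head G) (arcs G)"
  shows "kp G = card (tail G ` arcs G - head G ` arcs G)"
proof -
  define src where "src H = tail G ` arcs H - head G ` arcs H" for H :: "('a, 'b) pre_digraph"
  have src: "src H = src G \<inter> verts H" if "H \<in> components G" for H
  proof -
    have "tail G ` arcs H = tail G ` arcs G \<inter> verts H" "head G ` arcs H = head G ` arcs G \<inter> verts H"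
      using component_image[OF that order_refl] componentD(4)[OF wf_digraph that]
      by (simp_all add: Int_absorb1)
    then show ?thesis unfolding src_def by auto
  qed
  have sing: "\<exists>s. src H = {s}" if "H \<in> components G" "is_directed_path H" for H
    using directed_path_linear_arcs(3)[OF that(2)] componentD(5,6)[OF wf_digraph that(1)]
    by (simp add: src_def)
  have "bij_betw (\<lambda>H. the_elem (src H)) {H \<in> components G. is_directed_path H} (src G)"
  proof (rule bij_betwI')
    fix H K assume "H \<in> {H \<in> components G. is_directed_path H}"
      "K \<in> {H \<in> components G. is_directed_path H}"
    then have H: "H \<in> components G" "is_directed_path H"
      and K: "K \<in> components G" "is_directed_path K" by auto
    obtain s where s: "src H = {s}" using sing[OF H] ..
    obtain s' where s': "src K = {s'}" using sing[OF K] ..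
    have "s \<in> verts H" using src[OF H(1)] s by blast
    moreover have "s' \<in> verts K" using src[OF K(1)] s' by blast
    ultimately have "s = s' \<Longrightarrow> H = K" using component_unique[OF wf_digraph H(1) K(1)] by blast
    then show "the_elem (src H) = the_elem (src K) \<longleftrightarrow> H = K"
      using s s' by auto
  next
    fix H assume "H \<in> {H \<in> components G. is_directed_path H}"
    then have H: "H \<in> components G" "is_directed_path H" by auto
    obtain s where s: "src H = {s}" using sing[OF H] ..
    have "s \<in> src G" using src[OF H(1)] s by blast
    then show "the_elem (src H) \<in> src G" by (simp add: s)
  next
    fix s assume s: "s \<in> src G"
    then obtain a where a: "a \<in> arcs G" "tail G a = s" unfolding src_def by blast
    obtain H where H: "H \<in> components G" "a \<in> arcs H" using component_of_arc[OF a(1)] .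
    have p: "is_directed_path H"
    proof -
      have "is_directed_path H \<or> is_isolated_vertex H"
        using components_path_iff assms H(1) by blast
      then show ?thesis using H(2) by (auto simp: is_isolated_vertex_def)
    qed
    obtain s' where s': "src H = {s'}" using sing[OF H(1) p] ..
    have "s \<in> verts H" using component_arc_iff(1)[OF H(1) a(1)] H(2) a(2) by simp
    then have "s \<in> src H" using src[OF H(1)] s by blast
    then have "s = the_elem (src H)" using s' by simp
    then show "\<exists>H \<in> {H \<in> components G. is_directed_path H}. s = the_elem (src H)"
      using H(1) p by blast
  qed
  then show ?thesis unfolding kp_def src_def[of G, symmetric] by (rule bij_betw_same_card)
qed

section \<open>The polynomials as sums over cyclic and linear arc sets\<close>

lemma fin_digraph_spanning_sub:
  assumes "F \<subseteq> arcs G"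
  shows "fin_digraph (spanning_sub G F)"
  using assms finite_subset[OF assms finite_arcs]
  by unfold_locales (auto simp: spanning_sub_def)

lemma cycle_poly_eq:
  "cycle_poly G = (\<Sum>F | F \<subseteq> arcs G \<and> cyclic_arcs (tail G) (head G) F.
     X ^ card F * Y ^ card {A. min_balanced (tail G) (head G) F A})"
proof -
  have s: "arcs (spanning_sub G F) = F" "tail (spanning_sub G F) = tail G"
    "head (spanning_sub G F) = head G" for F
    by (simp_all add: spanning_sub_def)
  have ok: "(\<forall>H \<in> components (spanning_sub G F). is_directed_cycle H \<or> is_isolated_vertex H) \<longleftrightarrow>
      cyclic_arcs (tail G) (head G) F" if "F \<subseteq> arcs G" for F
    using fin_digraph.components_cycle_iff[OF fin_digraph_spanning_sub[OF that]] by (simp only: s)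
  show ?thesis unfolding cycle_poly_def
  proof (rule sum.cong)
    fix F assume "F \<in> {F. F \<subseteq> arcs G \<and> cyclic_arcs (tail G) (head G) F}"
    then have F: "F \<subseteq> arcs G" "cyclic_arcs (tail G) (head G) F" by auto
    show "X ^ card F * Y ^ kc (spanning_sub G F) = X ^ card F * Y ^ card {A. min_balanced (tail G) (head G) F A}"
      using fin_digraph.kc_eq[OF fin_digraph_spanning_sub[OF F(1)]] F(2) by (simp only: s)
  qed (use ok in blast)
qed

lemma path_poly_eq:
  "path_poly G = (\<Sum>F | F \<subseteq> arcs G \<and> linear_arcs (tail G) (head G) F.
     X ^ card F * Y ^ card (tail G ` F - head G ` F))"
proof -
  have s: "arcs (spanning_sub G F) = F" "tail (spanning_sub G F) = tail G"
    "head (spanning_sub G F) = head G" for F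
    by (simp_all add: spanning_sub_def)
  have ok: "(\<forall>H \<in> components (spanning_sub G F). is_directed_path H \<or> is_isolated_vertex H) \<longleftrightarrow>
      linear_arcs (tail G) (head G) F" if "F \<subseteq> arcs G" for F
    using fin_digraph.components_path_iff[OF fin_digraph_spanning_sub[OF that]] by (simp only: s)
  show ?thesis unfolding path_poly_def
  proof (rule sum.cong)
    fix F assume "F \<in> {F. F \<subseteq> arcs G \<and> linear_arcs (tail G) (head G) F}"
    then have F: "F \<subseteq> arcs G" "linear_arcs (tail G) (head G) F" by auto
    show "X ^ card F * Y ^ kp (spanning_sub G F) = X ^ card F * Y ^ card (tail G ` F - head G ` F)"
      using fin_digraph.kp_eq[OF fin_digraph_spanning_sub[OF F(1)]] F(2) by (simp only: s)
  qed (use ok in blast)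
qed

end

section \<open>Contraction and balanced arc sets\<close>

text \<open>The renaming inside \<open>identify\<close> as a function of its own; the name
  \<open>u\<close> survives.\<close>

definition merge :: "'a \<Rightarrow> 'a \<Rightarrow> 'a \<Rightarrow> 'a" where
  "merge u v w = (if w = v then u else w)"

lemma merge_image: "merge u v ` S = (if v \<in> S then insert u (S - {v}) else S)"
proof -
  have id: "merge u v ` T = T" if "v \<notin> T" for T
  proof -
    have "merge u v ` T = id ` T" by (rule image_cong) (use that in \<open>auto simp: merge_def\<close>)
    then show ?thesis by simp
  qed
  have "merge u v ` S = insert (merge u v v) (merge u v ` (S - {v}))" if "v \<in> S"
    using insert_Diff[OF that] image_insert by metis
  then show ?thesis using id[of S] id[of "S - {v}"] by (simp add: merge_def)
qed

text \<open>With tails \<open>S\<close> and heads \<open>T\<close>, the left side is balance after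
  renaming \<open>v\<close> to \<open>u\<close>, the right side balance with an arc from
  \<open>u\<close> to \<open>v\<close> added. As \<open>v\<close> is absent from \<open>T\<close>
  and from \<open>insert u (S - {v})\<close>, inserting it on both sides loses nothing.\<close>

lemma insert_swap_iff:
  assumes "u \<notin> S" "v \<notin> T" "v \<in> S" "u \<noteq> v"
  shows "insert u (S - {v}) = T \<longleftrightarrow> insert u S = insert v T"
proof -
  have "insert u S = insert v (insert u (S - {v}))" using assms(3) by (auto simp: insert_commute)
  moreover have "v \<notin> insert u (S - {v})" using assms(4) by simp
  ultimately show ?thesis using insert_ident[OF _ assms(2)] by metis
qed

lemma balanced_cong:
  assumes "\<And>a. a \<in> A \<Longrightarrow> t' a = t a \<and> h' a = h a"
  shows "balanced t' h' A \<longleftrightarrow> balanced t h A"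
proof -
  have "t' ` A = t ` A" "h' ` A = h ` A" by (rule image_cong[OF refl], simp add: assms)+
  then show ?thesis by (simp add: balanced_def)
qed

lemma min_balanced_cong:
  assumes "\<And>a. a \<in> A \<Longrightarrow> t' a = t a \<and> h' a = h a"
  shows "min_balanced t' h' A B \<longleftrightarrow> min_balanced t h A B"
proof (cases "B \<subseteq> A")
  case True
  have bal: "balanced t' h' C \<longleftrightarrow> balanced t h C" if "C \<subseteq> B" for C
  proof (rule balanced_cong)
    fix a assume "a \<in> C"
    then show "t' a = t a \<and> h' a = h a" using assms[of a] that True by blast
  qed
  then have "(\<forall>C \<subseteq> B. C \<noteq> {} \<longrightarrow> balanced t' h' C \<longrightarrow> C = B) \<longleftrightarrow>
      (\<forall>C \<subseteq> B. C \<noteq> {} \<longrightarrow> balanced t h C \<longrightarrow> C = B)"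
    by (intro all_cong) simp
  then show ?thesis using bal[OF order_refl] by (simp add: min_balanced_def)
qed (simp add: min_balanced_def)

text \<open>\<open>E\<close> stands for the arcs that survive contraction of \<open>e\<close>, those
  sharing neither tail nor head with it. Arcs from \<open>h e\<close> to \<open>t e\<close> are
  allowed and turn into loops.\<close>

locale nonloop_contraction =
  fixes t h :: "'b \<Rightarrow> 'a" and e :: 'b and E :: "'b set"
  assumes noloop: "t e \<noteq> h e" and E: "\<And>a. a \<in> E \<Longrightarrow> t a \<noteq> t e \<and> h a \<noteq> h e"
begin

abbreviation (input) "t' \<equiv> merge (t e) (h e) \<circ> t"
abbreviation (input) "h' \<equiv> merge (t e) (h e) \<circ> h"

lemma e_notin: "e \<notin> E"
proof
  assume "e \<in> E"
  then show False using E[of e] by simp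
qed

lemma ends_notin_image:
  assumes "A \<subseteq> E"
  shows "t e \<notin> t ` A" "h e \<notin> h ` A"
proof -
  have ne: "t a \<noteq> t e" "h a \<noteq> h e" if "a \<in> A" for a
    using E[OF subsetD[OF assms that]] by simp_all
  show "t e \<notin> t ` A" "h e \<notin> h ` A"
    by (rule notI; erule imageE; use ne in metis)+
qed

text \<open>No arc of \<open>E\<close> enters \<open>h e\<close>, so the renaming can only move
  tails.\<close>

lemma merge_head_image:
  assumes "A \<subseteq> E"
  shows "h' ` A = h ` A"
proof (rule image_cong)
  fix a assume "a \<in> A"
  then show "h' a = h a" using E[OF subsetD[OF assms]] by (simp add: merge_def)
qed simp

lemma merge_tail_image:
  "t' ` A = (if h e \<in> t ` A then insert (t e) (t ` A - {h e}) else t ` A)"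
  using merge_image[of "t e" "h e" "t ` A"] by (simp only: image_comp)

text \<open>If some arc of \<open>A\<close> leaves \<open>h e\<close>, then \<open>A\<close> alone
  is unbalanced, because \<open>h e\<close> is not a head in \<open>A\<close>, and
  \<open>insert_swap_iff\<close> applies. Otherwise the renaming does nothing, and adding
  \<open>e\<close> creates a head \<open>h e\<close> that is no tail.\<close>

lemma merge_balanced_iff:
  assumes "A \<subseteq> E"
  shows "balanced t' h' A \<longleftrightarrow> balanced t h A \<or> balanced t h (insert e A)"
proof -
  note n = ends_notin_image[OF assms]
  show ?thesis
  proof (cases "h e \<in> t ` A")
    case True
    have "insert (t e) (t ` A - {h e}) = h ` A \<longleftrightarrow> insert (t e) (t ` A) = insert (h e) (h ` A)"
      using insert_swap_iff[OF n True noloop] .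
    moreover have "t ` A \<noteq> h ` A" using n(2) True by metis
    ultimately show ?thesis
      using True merge_head_image[OF assms] merge_tail_image[of A] by (simp add: balanced_def)
  next
    case False
    have "insert (t e) (t ` A) \<noteq> insert (h e) (h ` A)" using False noloop by (metis insert_iff)
    then show ?thesis
      using False merge_head_image[OF assms] merge_tail_image[of A] by (simp add: balanced_def)
  qed
qed

text \<open>Renaming \<open>h e\<close> to \<open>t e\<close> causes no collision, since no arc of
  \<open>E\<close> leaves \<open>t e\<close>; likewise \<open>e\<close> brings a new tail and a new
  head.\<close>

lemma merge_inj_on:
  assumes "A \<subseteq> E"
  shows "inj_on t' A \<longleftrightarrow> inj_on t (insert e A)" "inj_on h' A \<longleftrightarrow> inj_on h (insert e A)"
proof -
  have n: "t e \<notin> t ` A" "h e \<notin> h ` A" "e \<notin> A"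
    using ends_notin_image[OF assms] e_notin assms by blast+
  have "t' a = t' b \<longleftrightarrow> t a = t b" if "a \<in> A" "b \<in> A" for a b
    using E[OF subsetD[OF assms that(1)]] E[OF subsetD[OF assms that(2)]]
    by (auto simp: merge_def)
  then have "inj_on t' A \<longleftrightarrow> inj_on t A" by (simp add: inj_on_def)
  then show "inj_on t' A \<longleftrightarrow> inj_on t (insert e A)" using n by simp
  have "h' a = h' b \<longleftrightarrow> h a = h b" if "a \<in> A" "b \<in> A" for a b
    using E[OF subsetD[OF assms that(1)]] E[OF subsetD[OF assms that(2)]]
    by (auto simp: merge_def)
  then have "inj_on h' A \<longleftrightarrow> inj_on h A" by (simp add: inj_on_def)
  then show "inj_on h' A \<longleftrightarrow> inj_on h (insert e A)" using n by simp
qed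

lemma inj_on_insert_arc:
  assumes "A \<subseteq> E"
  shows "inj_on t (insert e A) \<longleftrightarrow> inj_on t A" "inj_on h (insert e A) \<longleftrightarrow> inj_on h A"
proof -
  have "e \<notin> A" using e_notin assms by blast
  then show "inj_on t (insert e A) \<longleftrightarrow> inj_on t A" "inj_on h (insert e A) \<longleftrightarrow> inj_on h A"
    using ends_notin_image[OF assms] by simp_all
qed

lemma merge_linear_arcs:
  assumes "A \<subseteq> E"
  shows "linear_arcs t' h' A \<longleftrightarrow> linear_arcs t h (insert e A)"
proof -
  have "(\<forall>B \<subseteq> A. balanced t' h' B \<longrightarrow> B = {}) \<longleftrightarrow> (\<forall>B \<subseteq> insert e A. balanced t h B \<longrightarrow> B = {})"
  proof (intro iffI allI impI)
    fix B assume L: "\<forall>B \<subseteq> A. balanced t' h' B \<longrightarrow> B = {}"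
      and B: "B \<subseteq> insert e A" "balanced t h B"
    have BA: "B - {e} \<subseteq> A" using B(1) by blast
    have "balanced t h (B - {e}) \<or> balanced t h (insert e (B - {e}))"
      using B(2) by (cases "e \<in> B") (simp_all add: insert_absorb)
    then have "balanced t' h' (B - {e})"
      using merge_balanced_iff[of "B - {e}"] BA assms by blast
    then have "B - {e} = {}" using L BA by blast
    \<comment> \<open>This closes the one gap in the correspondence: a set consisting of
      \<open>e\<close> alone would become empty.\<close>
    moreover have "B \<noteq> {e}" using B(2) noloop by (auto simp: balanced_def)
    ultimately show "B = {}" by blast
  next
    fix B assume R: "\<forall>B \<subseteq> insert e A. balanced t h B \<longrightarrow> B = {}"
      and B: "B \<subseteq> A" "balanced t' h' B"
    have "balanced t h B \<or> balanced t h (insert e B)"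
      using merge_balanced_iff[of B] B assms by blast
    moreover have "\<not> balanced t h (insert e B)" using R B(1) by blast
    ultimately show "B = {}" using R B(1) by blast
  qed
  then show ?thesis by (simp only: linear_arcs_def merge_inj_on[OF assms])
qed

lemma merge_cyclic_arcs:
  assumes "A \<subseteq> E"
  shows "cyclic_arcs t' h' A \<longleftrightarrow> cyclic_arcs t h A \<or> cyclic_arcs t h (insert e A)"
  using merge_balanced_iff[OF assms] merge_inj_on[OF assms] inj_on_insert_arc[OF assms]
  by (simp only: cyclic_arcs_def) blast

text \<open>Removing \<open>e\<close> matches the cycles of \<open>insert e A\<close> with those of
  the contraction: a cycle through \<open>e\<close> gets shorter but does not vanish, since
  \<open>{e}\<close> is not balanced.\<close>

lemma card_min_balanced_merge:
  assumes A: "A \<subseteq> E" and inj: "inj_on h (insert e A)"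
  shows "card {B. min_balanced t' h' A B} = card {B. min_balanced t h (insert e A) B}"
proof -
  have eA: "e \<notin> A" using A e_notin by blast
  \<comment> \<open>The other arcs decide whether a balanced set contains \<open>e\<close>: if
    \<open>B\<close> does, another arc of \<open>B\<close> leaves \<open>h e\<close>; a balanced
    \<open>C\<close> with that arc also has an arc into \<open>h e\<close>, which is
    \<open>e\<close> by injectivity.\<close>
  have mono: "B \<subseteq> C" if "B \<subseteq> insert e A" "C \<subseteq> insert e A" "balanced t h B" "balanced t h C"
      "B - {e} \<subseteq> C - {e}" for B C
  proof (cases "e \<in> B")
    case True
    then have "h e \<in> h ` B" by simp
    then have "h e \<in> t ` B" using that(3) by (simp add: balanced_def)
    then obtain b where b: "b \<in> B" "t b = h e" by auto
    moreover have "b \<noteq> e" using b(2) noloop by auto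
    ultimately have "t b \<in> t ` C" using that(5) by blast
    then have "h e \<in> h ` C" using that(4) b(2) by (simp add: balanced_def)
    then obtain c where "c \<in> C" "h c = h e" by auto
    then have "e \<in> C" using inj_onD[OF inj, of c e] that(2) by blast
    then show ?thesis using that(5) by blast
  qed (use that(5) in blast)
  have eqI: "B = C" if "B \<subseteq> insert e A" "C \<subseteq> insert e A" "balanced t h B" "balanced t h C"
      "B - {e} = C - {e}" for B C
    using mono[OF that(1,2,3,4)] mono[OF that(2,1,4,3)] that(5) by blast
  have down: "B - {e} \<subseteq> A \<and> B - {e} \<noteq> {} \<and> balanced t' h' (B - {e})"
    if "B \<subseteq> insert e A" "B \<noteq> {}" "balanced t h B" for B
  proof -
    have BA: "B - {e} \<subseteq> A" using that(1) by blast
    have "balanced t h (B - {e}) \<or> balanced t h (insert e (B - {e}))"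
      using that(3) by (cases "e \<in> B") (simp_all add: insert_absorb)
    then have "balanced t' h' (B - {e})"
      using merge_balanced_iff[of "B - {e}"] BA A by blast
    moreover have "B \<noteq> {e}" using that(3) noloop by (auto simp: balanced_def)
    ultimately show ?thesis using that(2) BA by blast
  qed
  have up: "\<exists>C. C \<subseteq> insert e A \<and> C \<noteq> {} \<and> balanced t h C \<and> C - {e} = B"
    if "B \<subseteq> A" "B \<noteq> {}" "balanced t' h' B" for B
  proof -
    have "balanced t h B \<or> balanced t h (insert e B)"
      using merge_balanced_iff[of B] that A by blast
    moreover have "B - {e} = B" "insert e B - {e} = B" using that(1) eA by blast+
    moreover have "B \<subseteq> insert e A" "insert e B \<subseteq> insert e A" using that(1) by blast+
    ultimately show ?thesis using that(2) by (meson insert_not_empty)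
  qed
  have "bij_betw (\<lambda>B. B - {e}) {B. min_balanced t h (insert e A) B} {B. min_balanced t' h' A B}"
  proof (rule bij_betwI')
    fix B C assume "B \<in> {B. min_balanced t h (insert e A) B}" "C \<in> {B. min_balanced t h (insert e A) B}"
    then show "B - {e} = C - {e} \<longleftrightarrow> B = C"
      using eqI[of B C] by (auto simp: min_balanced_def)
  next
    fix B assume "B \<in> {B. min_balanced t h (insert e A) B}"
    then have B: "B \<subseteq> insert e A" "B \<noteq> {}" "balanced t h B"
      and min: "\<And>C. C \<subseteq> B \<Longrightarrow> C \<noteq> {} \<Longrightarrow> balanced t h C \<Longrightarrow> C = B"
      by (auto simp: min_balanced_def)
    \<comment> \<open>A smaller balanced set of the contraction lifts to a balanced set, which
      \<open>mono\<close> places inside \<open>B\<close>.\<close>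
    have "C = B - {e}" if C: "C \<subseteq> B - {e}" "C \<noteq> {}" "balanced t' h' C" for C
    proof -
      have "C \<subseteq> A" using C(1) B(1) by blast
      then obtain K where K: "K \<subseteq> insert e A" "K \<noteq> {}" "balanced t h K" "K - {e} = C"
        using up C(2,3) by blast
      then have "K \<subseteq> B" using mono[OF K(1) B(1) K(3) B(3)] C(1) by blast
      then show ?thesis using min[of K] K by blast
    qed
    then show "B - {e} \<in> {B. min_balanced t' h' A B}"
      using down[OF B] unfolding min_balanced_def by blast
  next
    fix B assume "B \<in> {B. min_balanced t' h' A B}"
    then have B: "B \<subseteq> A" "B \<noteq> {}" "balanced t' h' B"
      and min: "\<And>C. C \<subseteq> B \<Longrightarrow> C \<noteq> {} \<Longrightarrow> balanced t' h' C \<Longrightarrow> C = B"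
      by (auto simp: min_balanced_def)
    obtain K where K: "K \<subseteq> insert e A" "K \<noteq> {}" "balanced t h K" "K - {e} = B"
      using up[OF B] by blast
    have "C = K" if C: "C \<subseteq> K" "C \<noteq> {}" "balanced t h C" for C
    proof (rule eqI)
      show CA: "C \<subseteq> insert e A" using C(1) K(1) by blast
      show "C - {e} = K - {e}"
        using min[of "C - {e}"] down[OF CA C(2,3)] C(1) K(4) by blast
    qed (use C K in blast)+
    then show "\<exists>K \<in> {B. min_balanced t h (insert e A) B}. B = K - {e}"
      using K unfolding min_balanced_def by blast
  qed
  from bij_betw_same_card[OF this] show ?thesis by (rule sym)
qed

text \<open>In a balanced subset of \<open>E\<close>, \<open>h e\<close> is no head and therefore no
  tail, so the renaming moves nothing.\<close>

lemma merge_id_if_balanced: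
  assumes "A \<subseteq> E" "balanced t h A" "a \<in> A"
  shows "t' a = t a \<and> h' a = h a"
proof -
  have "t ` A = h ` A" using assms(2) by (simp add: balanced_def)
  then have "t a \<noteq> h e" using ends_notin_image(2)[OF assms(1)] assms(3) by (metis image_eqI)
  then show ?thesis using E[OF subsetD[OF assms(1,3)]] by (simp add: merge_def)
qed

text \<open>Shortening a path by \<open>e\<close> keeps its source up to renaming, unless
  \<open>e\<close> is the whole path. The cases are: some arc continues after \<open>e\<close>; none
  does but one precedes \<open>e\<close>; neither exists, and the source \<open>t e\<close> is
  lost.\<close>

lemma card_sources_merge:
  assumes A: "A \<subseteq> E" and fin: "finite A"
  shows "card (t ` insert e A - h ` insert e A) = card (t' ` A - h' ` A) +
    (if h e \<notin> t ` A \<and> t e \<notin> h ` A then 1 else 0)"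
proof -
  note n = ends_notin_image[OF A]
  consider "h e \<in> t ` A" | "h e \<notin> t ` A" "t e \<in> h ` A" | "h e \<notin> t ` A" "t e \<notin> h ` A" by blast
  then show ?thesis
  proof cases
    case 1
    have "insert u S - insert v T = insert u (S - {v}) - T" if "u \<noteq> v" for u v :: 'a and S T
      using that by blast
    note this[OF noloop, of "t ` A" "h ` A"]
    then show ?thesis using 1 merge_head_image[OF A] merge_tail_image[of A] by simp
  next
    case 2
    have "insert (t e) (t ` A) - insert (h e) (h ` A) = t ` A - h ` A"
      using 2 by (simp add: insert_Diff_if)
    then show ?thesis using 2 merge_head_image[OF A] merge_tail_image[of A] by simp
  next
    case 3
    have "insert (t e) (t ` A) - insert (h e) (h ` A) = insert (t e) (t ` A - h ` A)"
      using 3 noloop by (simp add: insert_Diff_if)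
    moreover have "card (insert (t e) (t ` A - h ` A)) = Suc (card (t ` A - h ` A))"
      using n fin by simp
    ultimately show ?thesis using 3 merge_head_image[OF A] merge_tail_image[of A] by simp
  qed
qed

end

text \<open>Here \<open>E\<close> stands for the arcs that remain when the vertex of the loop
  \<open>e\<close> is deleted.\<close>

locale loop_deletion =
  fixes t h :: "'b \<Rightarrow> 'a" and e :: 'b and E :: "'b set"
  assumes loop: "t e = h e" and E: "\<And>a. a \<in> E \<Longrightarrow> t a \<noteq> t e \<and> h a \<noteq> t e"
begin

lemma loop_notin_image:
  assumes "A \<subseteq> E"
  shows "t e \<notin> t ` A" "t e \<notin> h ` A"
proof -
  have ne: "t a \<noteq> t e" "h a \<noteq> t e" if "a \<in> A" for a
    using E[OF subsetD[OF assms that]] by simp_all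
  show "t e \<notin> t ` A" "t e \<notin> h ` A"
    by (rule notI; erule imageE; use ne in metis)+
qed

lemma balanced_insert_loop:
  assumes "A \<subseteq> E"
  shows "balanced t h (insert e A) \<longleftrightarrow> balanced t h A"
  using loop_notin_image[OF assms] by (simp add: balanced_def loop[symmetric] insert_ident)

lemma cyclic_arcs_insert_loop:
  assumes "A \<subseteq> E"
  shows "cyclic_arcs t h (insert e A) \<longleftrightarrow> cyclic_arcs t h A"
proof -
  have "t e \<notin> t ` A" "h e \<notin> h ` A" "e \<notin> A"
    using loop_notin_image[OF assms] by (auto simp: loop[symmetric])
  then show ?thesis using balanced_insert_loop[OF assms] by (simp add: cyclic_arcs_def)
qed

text \<open>The loop is balanced by itself, so \<open>{e}\<close> is the only minimal balanced set
  containing \<open>e\<close>. This extra cycle produces the factor \<open>Y\<close>.\<close>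

lemma card_min_balanced_insert_loop:
  assumes A: "A \<subseteq> E" and fin: "finite A"
  shows "card {B. min_balanced t h (insert e A) B} = Suc (card {B. min_balanced t h A B})"
proof -
  have eA: "e \<notin> A" using A E by blast
  have be: "balanced t h {e}" by (simp add: balanced_def loop)
  have "min_balanced t h (insert e A) B \<longleftrightarrow> B = {e} \<or> min_balanced t h A B" for B
  proof (cases "e \<in> B")
    case True
    then have "\<not> min_balanced t h A B" using eA by (auto simp: min_balanced_def)
    moreover have "B = {e}" if "min_balanced t h (insert e A) B"
    proof -
      have "\<forall>C \<subseteq> B. C \<noteq> {} \<longrightarrow> balanced t h C \<longrightarrow> C = B"
        using that by (simp add: min_balanced_def)
      moreover have "{e} \<subseteq> B" using True by blast
      ultimately have "{e} = B" using be by blast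
      then show ?thesis ..
    qed
    moreover have "min_balanced t h (insert e A) {e}"
      using be by (simp add: min_balanced_def subset_singleton_iff)
    ultimately show ?thesis by blast
  next
    case False
    then have "B \<subseteq> insert e A \<longleftrightarrow> B \<subseteq> A" "B \<noteq> {e}" by auto
    then show ?thesis by (simp add: min_balanced_def)
  qed
  then have "{B. min_balanced t h (insert e A) B} = insert {e} {B. min_balanced t h A B}"
    by blast
  moreover have "{e} \<notin> {B. min_balanced t h A B}" using eA by (auto simp: min_balanced_def)
  moreover have "finite {B. min_balanced t h A B}"
    by (rule finite_subset[of _ "Pow A"]) (use fin in \<open>auto simp: min_balanced_def\<close>)
  ultimately show ?thesis by simp
qed

end

section \<open>The recurrences\<close>

text \<open>Sets containing \<open>e\<close> are indexed by what remains without \<open>e\<close>,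
  so that they can be compared with arc sets of the contraction.\<close>

lemma sum_subsets_split:
  fixes f :: "'b set \<Rightarrow> 'c::comm_monoid_add"
  assumes "finite E" "e \<in> E"
  shows "(\<Sum>F | F \<subseteq> E \<and> P F. f F) =
    (\<Sum>F | F \<subseteq> E - {e} \<and> P F. f F) + (\<Sum>A | A \<subseteq> E - {e} \<and> P (insert e A). f (insert e A))"
proof -
  let ?S = "{F. F \<subseteq> E - {e} \<and> P F}" and ?T = "{A. A \<subseteq> E - {e} \<and> P (insert e A)}"
  have fin: "finite ?S" "finite ?T"
    by (rule finite_subset[of _ "Pow E"]; use assms(1) in auto)+
  have "F \<in> ?S \<union> insert e ` ?T" if F: "F \<subseteq> E" "P F" for F
  proof (cases "e \<in> F")
    case True
    then have "F = insert e (F - {e})" by blast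
    moreover have "F - {e} \<in> ?T" using F True by (auto simp: insert_absorb)
    ultimately show ?thesis by blast
  qed (use F in auto)
  moreover have "?S \<union> insert e ` ?T \<subseteq> {F. F \<subseteq> E \<and> P F}" using assms(2) by auto
  ultimately have "{F. F \<subseteq> E \<and> P F} = ?S \<union> insert e ` ?T" by blast
  moreover have "?S \<inter> insert e ` ?T = {}" by auto
  moreover have "inj_on (insert e) ?T"
  proof (rule inj_onI)
    fix A B assume "A \<in> ?T" "B \<in> ?T" "insert e A = insert e B"
    moreover from this have "e \<notin> A" "e \<notin> B" by auto
    ultimately show "A = B" using insert_ident by metis
  qed
  ultimately show ?thesis using fin by (simp add: sum.union_disjoint sum.reindex)
qed

section \<open>Arcs after deletion, contraction and extraction\<close>

context fin_digraph
begin

lemma fin_digraph_del_arc: "fin_digraph (del_arc e)"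
  by unfold_locales simp_all

lemma fin_digraph_del_vert: "fin_digraph (del_vert u)"
  by unfold_locales (auto simp: del_vert_simps)

lemma fin_digraph_identify: "fin_digraph (identify G u v)"
proof -
  have "identify G u v = \<lparr>verts = merge u v ` verts G, arcs = arcs G,
      tail = merge u v \<circ> tail G, head = merge u v \<circ> head G\<rparr>"
    by (simp add: identify_def Let_def merge_def[abs_def])
  then show ?thesis by unfold_locales simp_all
qed

lemma arc_contract_nonloop:
  assumes "tail G e \<noteq> head G e"
  shows "arcs (arc_contract G e) = {a \<in> arcs G. tail G a \<noteq> tail G e \<and> head G a \<noteq> head G e}"
    "tail (arc_contract G e) = merge (tail G e) (head G e) \<circ> tail G"
    "head (arc_contract G e) = merge (tail G e) (head G e) \<circ> head G"
  using assms
  by (auto simp: arc_contract_def identify_def spanning_sub_def merge_def fun_eq_iff Let_def)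

lemma fin_digraph_arc_contract: "fin_digraph (arc_contract G e)"
proof -
  have "fin_digraph (spanning_sub G {a \<in> arcs G. tail G a \<noteq> tail G e \<and> head G a \<noteq> head G e})"
    by (rule fin_digraph_spanning_sub) blast
  from fin_digraph.fin_digraph_identify[OF this] fin_digraph_del_vert show ?thesis
    by (simp add: arc_contract_def Let_def)
qed

lemma arcs_arc_extract:
  "arcs (arc_extract G e) = {a \<in> arcs G. tail G a \<noteq> tail G e \<and> head G a \<noteq> tail G e \<and>
     tail G a \<noteq> head G e \<and> head G a \<noteq> head G e}"
  "tail (arc_extract G e) = tail G" "head (arc_extract G e) = head G"
  by (auto simp: arc_extract_def pre_digraph.del_vert_simps)

text \<open>Of the arcs kept by contraction, extraction drops just those meeting the merged vertex.
  The extra condition is the one that decides the correction in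
  \<open>card_sources_merge\<close>.\<close>

lemma subset_arcs_arc_extract_iff:
  "A \<subseteq> arcs (arc_extract G e) \<longleftrightarrow>
     A \<subseteq> {a \<in> arcs G. tail G a \<noteq> tail G e \<and> head G a \<noteq> head G e} \<and>
     head G e \<notin> tail G ` A \<and> tail G e \<notin> head G ` A"
proof -
  have "x \<notin> f ` A \<longleftrightarrow> (\<forall>a \<in> A. f a \<noteq> x)" for x and f :: "'b \<Rightarrow> 'a"
    by (metis imageE image_eqI)
  then show ?thesis
    unfolding arcs_arc_extract subset_eq mem_Collect_eq ball_conj_distrib by blast
qed

lemma fin_digraph_arc_extract: "fin_digraph (arc_extract G e)"
  unfolding arc_extract_def
  by (rule fin_digraph.fin_digraph_del_vert[OF fin_digraph_del_vert])

lemma card_insert_arc: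
  assumes "A \<subseteq> arcs G" "e \<notin> A"
  shows "card (insert e A) = Suc (card A)"
  using assms finite_subset[OF assms(1) finite_arcs] by simp

section \<open>Separating the arc sets with and without the chosen arc\<close>

lemma cycle_poly_split:
  assumes "e \<in> arcs G"
  shows "cycle_poly G = cycle_poly (arc_delete G e) +
    (\<Sum>A | A \<subseteq> arcs G - {e} \<and> cyclic_arcs (tail G) (head G) (insert e A).
       X ^ card (insert e A) * Y ^ card {B. min_balanced (tail G) (head G) (insert e A) B})"
  unfolding cycle_poly_eq fin_digraph.cycle_poly_eq[OF fin_digraph_del_arc] arc_delete_def
    del_arc_simps
  by (rule sum_subsets_split) (simp_all add: assms)

lemma path_poly_split:
  assumes "e \<in> arcs G"
  shows "path_poly G = path_poly (arc_delete G e) +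
    (\<Sum>A | A \<subseteq> arcs G - {e} \<and> linear_arcs (tail G) (head G) (insert e A).
       X ^ card (insert e A) * Y ^ card (tail G ` insert e A - head G ` insert e A))"
  unfolding path_poly_eq fin_digraph.path_poly_eq[OF fin_digraph_del_arc] arc_delete_def
    del_arc_simps
  by (rule sum_subsets_split) (simp_all add: assms)

text \<open>A second arc with the tail or the head of \<open>e\<close> would break injectivity, so
  only arcs kept by contraction can accompany \<open>e\<close>.\<close>

lemma inj_on_insert_arc_subset:
  assumes "A \<subseteq> arcs G - {e}" "inj_on (tail G) (insert e A)" "inj_on (head G) (insert e A)"
  shows "A \<subseteq> {a \<in> arcs G. tail G a \<noteq> tail G e \<and> head G a \<noteq> head G e}"
proof
  fix a assume a: "a \<in> A"
  then have "a \<in> arcs G" "a \<noteq> e" using assms(1) by auto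
  then show "a \<in> {a \<in> arcs G. tail G a \<noteq> tail G e \<and> head G a \<noteq> head G e}"
    using a inj_onD[OF assms(2), of a e] inj_onD[OF assms(3), of a e] by auto
qed

section \<open>Recurrences for loops and for other arcs\<close>

lemma cycle_poly_loop:
  assumes e: "e \<in> arcs G" and loop: "tail G e = head G e"
  shows "cycle_poly G = cycle_poly (arc_delete G e) + X * Y * cycle_poly (arc_contract G e)"
proof -
  let ?t = "tail G" and ?h = "head G"
  define E' where "E' = {a \<in> arcs G. ?t a \<noteq> ?t e \<and> ?h a \<noteq> ?t e}"
  have sub: "E' \<subseteq> arcs G" "e \<notin> E'" by (auto simp: E'_def)
  interpret loop_deletion ?t ?h e E'
    by unfold_locales (simp_all add: loop E'_def)
  note insert_loop = cyclic_arcs_insert_loop card_min_balanced_insert_loop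
  have contract: "arc_contract G e = del_vert (?t e)" by (simp add: arc_contract_def loop)
  have "{A. A \<subseteq> arcs G - {e} \<and> cyclic_arcs ?t ?h (insert e A)} = {A. A \<subseteq> E' \<and> cyclic_arcs ?t ?h A}"
  proof -
    have "A \<subseteq> E'" if "A \<subseteq> arcs G - {e}" "cyclic_arcs ?t ?h (insert e A)" for A
      using inj_on_insert_arc_subset[OF that(1)] that(2) loop by (simp add: cyclic_arcs_def E'_def)
    moreover have "E' \<subseteq> arcs G - {e}" using sub by blast
    ultimately have "A \<subseteq> arcs G - {e} \<and> cyclic_arcs ?t ?h (insert e A) \<longleftrightarrow>
        A \<subseteq> E' \<and> cyclic_arcs ?t ?h A" for A
      using insert_loop(1)[of A] by (metis subset_trans)
    then show ?thesis by simp
  qed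
  then have "(\<Sum>A | A \<subseteq> arcs G - {e} \<and> cyclic_arcs ?t ?h (insert e A).
        X ^ card (insert e A) * Y ^ card {B. min_balanced ?t ?h (insert e A) B}) =
      (\<Sum>A | A \<subseteq> E' \<and> cyclic_arcs ?t ?h A. X * Y * (X ^ card A * Y ^ card {B. min_balanced ?t ?h A B}))"
  proof (rule sum.cong)
    fix A assume "A \<in> {A. A \<subseteq> E' \<and> cyclic_arcs ?t ?h A}"
    then have A: "A \<subseteq> E'" by blast
    then have AG: "A \<subseteq> arcs G" "e \<notin> A" using sub by auto
    have "finite A" using finite_subset[OF AG(1) finite_arcs] .
    \<comment> \<open>The loop adds one arc and one cycle, hence the factor
      \<open>X * Y\<close>.\<close>
    show "X ^ card (insert e A) * Y ^ card {B. min_balanced ?t ?h (insert e A) B} =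
        X * Y * (X ^ card A * Y ^ card {B. min_balanced ?t ?h A B})"
      unfolding card_insert_arc[OF AG] insert_loop(2)[OF A \<open>finite A\<close>] power_Suc
      by (simp only: mult_ac)
  qed
  also have "\<dots> = X * Y * cycle_poly (arc_contract G e)"
    unfolding contract fin_digraph.cycle_poly_eq[OF fin_digraph_del_vert] del_vert_simps E'_def
    by (simp add: sum_distrib_left)
  finally show ?thesis using cycle_poly_split[OF e] by simp
qed

text \<open>Contraction counts two disjoint families: \<open>?S\<close>, where adding
  \<open>e\<close> gives a cyclic set, and \<open>?T\<close>, where the merged vertex is isolated.
  Only \<open>?S\<close> comes from cyclic sets of \<open>G\<close> containing \<open>e\<close>; the
  sum over \<open>?T\<close> belongs to the extraction and is subtracted.\<close>

lemma cycle_poly_nonloop: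
  assumes e: "e \<in> arcs G" and noloop: "tail G e \<noteq> head G e"
  shows "cycle_poly G = cycle_poly (arc_delete G e) + X * cycle_poly (arc_contract G e) -
    X * cycle_poly (arc_extract G e)"
proof -
  let ?t = "tail G" and ?h = "head G"
  let ?t' = "merge (?t e) (?h e) \<circ> ?t" and ?h' = "merge (?t e) (?h e) \<circ> ?h"
  define E' where "E' = {a \<in> arcs G. ?t a \<noteq> ?t e \<and> ?h a \<noteq> ?h e}"
  have sub: "E' \<subseteq> arcs G" "e \<notin> E'" by (auto simp: E'_def)
  interpret nonloop_contraction ?t ?h e E'
    by unfold_locales (simp_all add: noloop E'_def)
  have finE: "finite E'" using sub(1) finite_subset finite_arcs by blast
  let ?w = "\<lambda>t h A. X ^ card A * Y ^ card {B. min_balanced t h A B}"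
  let ?S = "{A. A \<subseteq> E' \<and> cyclic_arcs ?t ?h (insert e A)}"
  let ?T = "{A. A \<subseteq> E' \<and> cyclic_arcs ?t ?h A}"
  have fin: "finite ?S" "finite ?T" using finE by simp_all
  \<comment> \<open>Balance both with and without \<open>e\<close> would make
    \<open>head G e\<close> a head in \<open>A\<close>, which is impossible in
    \<open>E'\<close>.\<close>
  have disj: "?S \<inter> ?T = {}"
  proof -
    have False if A: "A \<subseteq> E'" "cyclic_arcs ?t ?h (insert e A)" "cyclic_arcs ?t ?h A" for A
    proof -
      have eq: "?t ` A = ?h ` A" "insert (?t e) (?t ` A) = insert (?h e) (?h ` A)"
        using A(2,3) by (simp_all add: cyclic_arcs_def balanced_def)
      then have "?h e \<in> insert (?t e) (?t ` A)" by simp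
      then have "?h e \<in> ?h ` A" using noloop eq(1) by simp
      then show False using ends_notin_image(2)[OF A(1)] by blast
    qed
    then show ?thesis by blast
  qed
  have "{A. A \<subseteq> arcs G - {e} \<and> cyclic_arcs ?t ?h (insert e A)} = ?S"
  proof -
    have "A \<subseteq> E'" if "A \<subseteq> arcs G - {e}" "cyclic_arcs ?t ?h (insert e A)" for A
      using inj_on_insert_arc_subset[OF that(1)] that(2) by (simp add: cyclic_arcs_def E'_def)
    moreover have "E' \<subseteq> arcs G - {e}" using sub by blast
    ultimately show ?thesis by blast
  qed
  then have "(\<Sum>A | A \<subseteq> arcs G - {e} \<and> cyclic_arcs ?t ?h (insert e A). ?w ?t ?h (insert e A)) =
      (\<Sum>A\<in>?S. X * ?w ?t' ?h' A)"
  proof (rule sum.cong)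
    fix A assume "A \<in> ?S"
    then have A: "A \<subseteq> E'" "inj_on ?h (insert e A)" by (auto simp: cyclic_arcs_def)
    then have AG: "A \<subseteq> arcs G" "e \<notin> A" using sub by auto
    then show "?w ?t ?h (insert e A) = X * ?w ?t' ?h' A"
      using card_insert_arc[OF AG] card_min_balanced_merge[OF A]
      by simp
  qed
  moreover have "X * cycle_poly (arc_contract G e) = (\<Sum>A\<in>?S. X * ?w ?t' ?h' A) +
      (\<Sum>A\<in>?T. X * ?w ?t' ?h' A)"
  proof -
    have "{A. A \<subseteq> E' \<and> cyclic_arcs ?t' ?h' A} = ?S \<union> ?T"
      using merge_cyclic_arcs by blast
    then show ?thesis
      unfolding fin_digraph.cycle_poly_eq[OF fin_digraph_arc_contract]
        arc_contract_nonloop[OF noloop] E'_def[symmetric]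
      by (simp only: sum.union_disjoint[OF fin disj] distrib_left sum_distrib_left)
  qed
  moreover have "X * cycle_poly (arc_extract G e) = (\<Sum>A\<in>?T. X * ?w ?t' ?h' A)"
  proof -
    \<comment> \<open>Tails and heads of a cyclic subset of \<open>E'\<close> agree, while
      \<open>tail G e\<close> is no tail and \<open>head G e\<close> no head; hence neither end of
      \<open>e\<close> is touched.\<close>
    have "A \<subseteq> arcs (arc_extract G e) \<longleftrightarrow> A \<subseteq> E'" if "cyclic_arcs ?t ?h A" for A
    proof
      assume A: "A \<subseteq> E'"
      have "?t ` A = ?h ` A" using that by (simp add: cyclic_arcs_def balanced_def)
      then have "?t e \<notin> ?h ` A" "?h e \<notin> ?t ` A"
        using ends_notin_image[OF A] by simp_all
      then show "A \<subseteq> arcs (arc_extract G e)"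
        using A by (simp add: subset_arcs_arc_extract_iff E'_def)
    qed (auto simp: arcs_arc_extract E'_def)
    then have T: "{A. A \<subseteq> arcs (arc_extract G e) \<and> cyclic_arcs ?t ?h A} = ?T" by blast
    have w: "?w ?t ?h A = ?w ?t' ?h' A" if "A \<in> ?T" for A
    proof -
      from that have A: "A \<subseteq> E'" "balanced ?t ?h A" by (auto simp: cyclic_arcs_def)
      have "min_balanced ?t' ?h' A B \<longleftrightarrow> min_balanced ?t ?h A B" for B
        by (rule min_balanced_cong) (rule merge_id_if_balanced[OF A])
      then show ?thesis by simp
    qed
    then show ?thesis
      unfolding fin_digraph.cycle_poly_eq[OF fin_digraph_arc_extract] arcs_arc_extract(2,3) T
        sum_distrib_left
      by (intro sum.cong refl) (simp only: w)
  qed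
  ultimately show ?thesis using cycle_poly_split[OF e] by simp
qed

text \<open>A loop alone is a nonempty balanced set, so no linear set contains it.\<close>

lemma path_poly_loop:
  assumes e: "e \<in> arcs G" and loop: "tail G e = head G e"
  shows "path_poly G = path_poly (arc_delete G e)"
proof -
  have "balanced (tail G) (head G) {e}" by (simp add: balanced_def loop)
  then have "\<not> linear_arcs (tail G) (head G) (insert e A)" for A
    unfolding linear_arcs_def by (meson empty_subsetI insert_mono insert_not_empty)
  then show ?thesis using path_poly_split[OF e] by simp
qed

text \<open>Contraction preserves the number of paths except where \<open>e\<close> is a whole path
  component, which is then lost. Those sets are counted by extraction; their weight has an
  additional factor \<open>Y\<close>, and writing it as \<open>1 + (Y - 1)\<close> gives the
  correction.\<close>

lemma path_poly_nonloop:
  assumes e: "e \<in> arcs G" and noloop: "tail G e \<noteq> head G e"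
  shows "path_poly G = path_poly (arc_delete G e) + X * path_poly (arc_contract G e) +
    X * (Y - 1) * path_poly (arc_extract G e)"
proof -
  let ?t = "tail G" and ?h = "head G"
  let ?t' = "merge (?t e) (?h e) \<circ> ?t" and ?h' = "merge (?t e) (?h e) \<circ> ?h"
  define E' where "E' = {a \<in> arcs G. ?t a \<noteq> ?t e \<and> ?h a \<noteq> ?h e}"
  have sub: "E' \<subseteq> arcs G" "e \<notin> E'" by (auto simp: E'_def)
  interpret nonloop_contraction ?t ?h e E'
    by unfold_locales (simp_all add: noloop E'_def)
  have finE: "finite E'" using sub(1) finite_subset finite_arcs by blast
  let ?w = "\<lambda>t h A. X ^ card A * Y ^ card (t ` A - h ` A)"
  let ?S = "{A. A \<subseteq> E' \<and> linear_arcs ?t' ?h' A}"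
  \<comment> \<open>This says that the merged vertex is isolated, or that \<open>e\<close> is a
    component by itself in the subgraph with arc set \<open>insert e A\<close>.\<close>
  let ?iso = "\<lambda>A. ?h e \<notin> ?t ` A \<and> ?t e \<notin> ?h ` A"
  have fin: "finite ?S" using finE by simp
  have id: "?t' a = ?t a \<and> ?h' a = ?h a" if "A \<subseteq> E'" "?iso A" "a \<in> A" for A a
  proof -
    have "?t a \<in> ?t ` A" using that(3) by (rule imageI)
    then have "?t a \<noteq> ?h e" using that(2) by metis
    then show ?thesis using E[OF subsetD[OF that(1,3)]] by (simp add: merge_def)
  qed
  have "{A. A \<subseteq> arcs G - {e} \<and> linear_arcs ?t ?h (insert e A)} = ?S"
  proof -
    have "A \<subseteq> E'" if "A \<subseteq> arcs G - {e}" "linear_arcs ?t ?h (insert e A)" for A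
      using inj_on_insert_arc_subset[OF that(1)] that(2) by (simp add: linear_arcs_def E'_def)
    moreover have "E' \<subseteq> arcs G - {e}" using sub by blast
    ultimately have "A \<subseteq> arcs G - {e} \<and> linear_arcs ?t ?h (insert e A) \<longleftrightarrow>
        A \<subseteq> E' \<and> linear_arcs ?t' ?h' A" for A
      using merge_linear_arcs[of A] by (metis subset_trans)
    then show ?thesis by (simp only:)
  qed
  then have "(\<Sum>A | A \<subseteq> arcs G - {e} \<and> linear_arcs ?t ?h (insert e A). ?w ?t ?h (insert e A)) =
      (\<Sum>A\<in>?S. X * ?w ?t' ?h' A + (if ?iso A then X * (Y - 1) * ?w ?t' ?h' A else 0))"
  proof (rule sum.cong)
    fix A assume "A \<in> ?S"
    then have A: "A \<subseteq> E'" by blast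
    then have AG: "A \<subseteq> arcs G" "e \<notin> A" using sub by auto
    have "finite A" using A finE finite_subset by blast
    note c = card_sources_merge[OF A this] card_insert_arc[OF AG]
    have ring: "x * p * (q * y) = x * (p * q) + x * (y - 1) * (p * q)" for x y p q :: "int poly poly"
      by (simp add: algebra_simps)
    show "?w ?t ?h (insert e A) =
        X * ?w ?t' ?h' A + (if ?iso A then X * (Y - 1) * ?w ?t' ?h' A else 0)"
    proof (cases "?iso A")
      case True
      then show ?thesis
        unfolding c by (simp only: if_True simp_thms power_Suc power_add power_one_right) (rule ring)
    next
      case False
      then show ?thesis unfolding c by (simp only: if_False power_Suc add_0_right mult.assoc)
    qed
  qed
  also have "\<dots> = (\<Sum>A\<in>?S. X * ?w ?t' ?h' A) +
      (\<Sum>A\<in>{A \<in> ?S. ?iso A}. X * (Y - 1) * ?w ?t' ?h' A)"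
    by (simp only: sum.distrib sum.inter_filter[OF fin])
  also have "(\<Sum>A\<in>?S. X * ?w ?t' ?h' A) = X * path_poly (arc_contract G e)"
    unfolding fin_digraph.path_poly_eq[OF fin_digraph_arc_contract]
      arc_contract_nonloop[OF noloop] E'_def[symmetric]
    by (simp only: sum_distrib_left)
  also have "(\<Sum>A\<in>{A \<in> ?S. ?iso A}. X * (Y - 1) * ?w ?t' ?h' A) =
      X * (Y - 1) * path_poly (arc_extract G e)"
  proof -
    have ext: "A \<subseteq> arcs (arc_extract G e) \<longleftrightarrow> A \<subseteq> E' \<and> ?iso A" for A
      unfolding subset_arcs_arc_extract_iff E'_def by (rule refl)
    \<comment> \<open>Merging does not change the ends of these arcs, so contraction and extraction
      agree on linearity and, below, on weights.\<close>
    have lin: "linear_arcs ?t' ?h' A \<longleftrightarrow> linear_arcs ?t ?h A" if "A \<subseteq> E'" "?iso A" for A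
    proof -
      have "balanced ?t' ?h' B \<longleftrightarrow> balanced ?t ?h B" if "B \<subseteq> A" for B
        by (rule balanced_cong) (rule id[OF \<open>A \<subseteq> E'\<close> \<open>?iso A\<close> subsetD[OF that]])
      moreover have "inj_on ?t' A \<longleftrightarrow> inj_on ?t A" "inj_on ?h' A \<longleftrightarrow> inj_on ?h A"
        by (rule inj_on_cong, rule id[OF that, THEN conjunct1], assumption)
          (rule inj_on_cong, rule id[OF that, THEN conjunct2], assumption)
      ultimately show ?thesis by (simp add: linear_arcs_def)
    qed
    have "{A \<in> ?S. ?iso A} = {A. A \<subseteq> arcs (arc_extract G e) \<and> linear_arcs ?t ?h A}"
      unfolding ext using lin by (intro Collect_cong) (simp only: mem_Collect_eq, metis)
    moreover have "?w ?t' ?h' A = ?w ?t ?h A" if "A \<subseteq> arcs (arc_extract G e)" for A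
    proof -
      have "A \<subseteq> E'" "?iso A" using that ext by blast+
      note id = id[OF this]
      have "?t' ` A = ?t ` A" by (rule image_cong[OF refl id[THEN conjunct1]])
      moreover have "?h' ` A = ?h ` A" by (rule image_cong[OF refl id[THEN conjunct2]])
      ultimately show ?thesis by (simp only:)
    qed
    ultimately show ?thesis
      unfolding fin_digraph.path_poly_eq[OF fin_digraph_arc_extract] arcs_arc_extract(2,3)
        sum_distrib_left
      by (intro sum.cong) (simp_all only: mem_Collect_eq)
  qed
  finally show ?thesis using path_poly_split[OF e] by simp
qed

end

theorem theorem3p1:
  fixes D :: "('a, 'b) pre_digraph" and e :: 'b
  assumes "fin_digraph D" and "e \<in> arcs D"
  shows "cycle_poly D =
           (if tail D e = head D e
            then cycle_poly (arc_delete D e) + X * Y * cycle_poly (arc_contract D e)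
            else cycle_poly (arc_delete D e) + X * cycle_poly (arc_contract D e)
                 - X * cycle_poly (arc_extract D e))
       \<and> path_poly D =
           (if tail D e = head D e
            then path_poly (arc_delete D e)
            else path_poly (arc_delete D e) + X * path_poly (arc_contract D e)
                 + X * (Y - 1) * path_poly (arc_extract D e))"
proof -
  interpret fin_digraph D by (rule assms(1))
  show ?thesis
    using cycle_poly_loop[OF assms(2)] cycle_poly_nonloop[OF assms(2)]
      path_poly_loop[OF assms(2)] path_poly_nonloop[OF assms(2)]
    by (cases "tail D e = head D e") simp_all
qed

end
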